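(* Let $\mathbb{K}$ be a field and let $p,q,\lambda,\mu\in\mathbb{K}^{\ast}$ be such that neither $p$ nor $q$ is a root of unity. Then the group of $\mathbb{K}$-algebra automorphisms of $\mathcal{A}_p(\lambda,\mu,\mathbb{K}_q[s,t])$ is $$\mathrm{Aut}_{\mathbb{K}}(\mathcal{A}_p(\lambda,\mu,\mathbb{K}_q[s,t]))=\{\varphi_{\alpha,\beta,\gamma}\mid \alpha,\beta,\gamma\in\mathbb{K}^{\ast}\}\cong(\mathbb{K}^{\ast})^3,$$ where $\varphi_{\alpha,\beta,\gamma}$ is the $\mathbb{K}$-algebra automorphism determined by $\varphi_{\alpha,\beta,\gamma}(x)=\alpha x$, $\varphi_{\alpha,\beta,\gamma}(y)=\alpha^{-1}y$, $\varphi_{\alpha,\beta,\gamma}(s)=\beta s$, $\varphi_{\alpha,\beta,\gamma}(t)=\gamma t$.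
   Context: For a field $\mathbb{K}$ and $p,q,\lambda,\mu\in\mathbb{K}^{\ast}$, $\mathcal{A}_p(\lambda,\mu,\mathbb{K}_q[s,t])$ denotes the associative unital $\mathbb{K}$-algebra generated by $x,y,s,t$ subject to the relations $$xy-pyx=1,\quad st=qts,\quad sx=\lambda xs,\quad sy=\lambda^{-1}ys,\quad tx=\mu xt,\quad ty=\mu^{-1}yt.$$ The number $1$ counts as a root of unity. *)

theory Defs
  imports
    "HOL-Library.Poly_Mapping"
    "HOL-Algebra.QuotRing"
    "HOL-Algebra.Module"
    "HOL-Algebra.Bij"
    "HOL-Algebra.Algebraic_Closure_Type"
begin

section \<open>Free associative algebras\<close>

text \<open>
  Words are lists wrapped in a new type, so that the additive notation required by
  \<^typ>\<open>'a \<Rightarrow>\<^sub>0 'b\<close> does not become an instance for lists themselves. Finitely supported functions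
  on words with their convolution product form the free unital associative algebra
  \<open>\<K>\<langle>G\<rangle>\<close>.
\<close>

datatype 'g free_word = Word "'g list"

instantiation free_word :: (type) monoid_add
begin

definition zero_free_word :: "'a free_word" where
  "0 = Word []"

fun plus_free_word :: "'a free_word \<Rightarrow> 'a free_word \<Rightarrow> 'a free_word" where
  "Word u + Word v = Word (u @ v)"

instance
proof
  fix a b c :: "'a free_word"
  show "a + b + c = a + (b + c)"
    by (cases a; cases b; cases c) simp
  show "0 + a = a" "a + 0 = a"
    by (cases a; simp add: zero_free_word_def)+
qed

end

type_synonym ('g, 'k) free_alg = "'g free_word \<Rightarrow>\<^sub>0 'k"

definition free_var :: "'g \<Rightarrow> ('g, 'k::comm_ring_1) free_alg" where
  "free_var g = Poly_Mapping.single (Word [g]) 1"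

definition free_const :: "'k::comm_ring_1 \<Rightarrow> ('g, 'k) free_alg" where
  "free_const a = Poly_Mapping.single 0 a"

section \<open>Algebras given by generators and relations\<close>

text \<open>
  The quotient of the free algebra by the two-sided ideal generated by \<open>R\<close>. The scalar \<open>a\<close>
  acts as multiplication by the image of the constant \<open>a\<close>.
\<close>

definition relation_ideal ::
    "('g, 'k::comm_ring_1) free_alg set \<Rightarrow> ('g, 'k) free_alg set" where
  "relation_ideal R = Idl\<^bsub>ring_of_type_algebra\<^esub> R"

definition presented_class ::
    "('g, 'k::comm_ring_1) free_alg set \<Rightarrow> ('g, 'k) free_alg \<Rightarrow> ('g, 'k) free_alg set" where
  "presented_class R f = relation_ideal R +>\<^bsub>ring_of_type_algebra\<^esub> f"

definition presented_algebra ::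
    "('g, 'k::comm_ring_1) free_alg set \<Rightarrow> ('k, ('g, 'k) free_alg set) module" where
  "presented_algebra R =
     (let Q = ring_of_type_algebra Quot relation_ideal R
      in ring.extend Q \<lparr>module.smult = (\<lambda>a c. presented_class R (free_const a) \<otimes>\<^bsub>Q\<^esub> c)\<rparr>)"

section \<open>Automorphism groups of algebras\<close>

text \<open>The base ring of an algebra is the whole type \<^typ>\<open>'k\<close>.\<close>

definition algebra_hom ::
    "('k, 'a, 'm) module_scheme \<Rightarrow> ('k, 'b, 'n) module_scheme \<Rightarrow> ('a \<Rightarrow> 'b) set" where
  "algebra_hom A B =
     {h \<in> ring_hom A B. \<forall>c. \<forall>u \<in> carrier A. h (c \<odot>\<^bsub>A\<^esub> u) = c \<odot>\<^bsub>B\<^esub> h u}"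

definition algebra_AutoGroup :: "('k, 'a, 'm) module_scheme \<Rightarrow> ('a \<Rightarrow> 'a) monoid" where
  "algebra_AutoGroup A =
     BijGroup (carrier A) \<lparr>carrier := algebra_hom A A \<inter> Bij (carrier A)\<rparr>"

section \<open>The algebra \<open>\<A>\<^sub>p(\<lambda>,\<mu>,\<K>\<^sub>q[s,t])\<close>\<close>

text \<open>The arguments \<open>l\<close> and \<open>m\<close> stand for \<open>\<lambda>\<close> and \<open>\<mu>\<close>.\<close>

datatype gen = Gx | Gy | Gs | Gt

definition A_relations :: "'k::field \<Rightarrow> 'k \<Rightarrow> 'k \<Rightarrow> 'k \<Rightarrow> (gen, 'k) free_alg set" where
  "A_relations p l m q =
     {free_var Gx * free_var Gy - free_const p * free_var Gy * free_var Gx - 1,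
      free_var Gs * free_var Gt - free_const q * free_var Gt * free_var Gs,
      free_var Gs * free_var Gx - free_const l * free_var Gx * free_var Gs,
      free_var Gs * free_var Gy - free_const (inverse l) * free_var Gy * free_var Gs,
      free_var Gt * free_var Gx - free_const m * free_var Gx * free_var Gt,
      free_var Gt * free_var Gy - free_const (inverse m) * free_var Gy * free_var Gt}"

definition A_alg :: "'k::field \<Rightarrow> 'k \<Rightarrow> 'k \<Rightarrow> 'k \<Rightarrow> ('k, (gen, 'k) free_alg set) module" where
  "A_alg p l m q = presented_algebra (A_relations p l m q)"

definition A_gen :: "'k::field \<Rightarrow> 'k \<Rightarrow> 'k \<Rightarrow> 'k \<Rightarrow> gen \<Rightarrow> (gen, 'k) free_alg set" where
  "A_gen p l m q g = presented_class (A_relations p l m q) (free_var g)"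

definition is_scaling ::
    "'k::field \<Rightarrow> 'k \<Rightarrow> 'k \<Rightarrow> 'k \<Rightarrow> 'k \<Rightarrow> 'k \<Rightarrow> 'k
      \<Rightarrow> ((gen, 'k) free_alg set \<Rightarrow> (gen, 'k) free_alg set) \<Rightarrow> bool" where
  "is_scaling p l m q \<alpha> \<beta> \<gamma> h \<longleftrightarrow>
     h (A_gen p l m q Gx) = \<alpha> \<odot>\<^bsub>A_alg p l m q\<^esub> A_gen p l m q Gx \<and>
     h (A_gen p l m q Gy) = inverse \<alpha> \<odot>\<^bsub>A_alg p l m q\<^esub> A_gen p l m q Gy \<and>
     h (A_gen p l m q Gs) = \<beta> \<odot>\<^bsub>A_alg p l m q\<^esub> A_gen p l m q Gs \<and>
     h (A_gen p l m q Gt) = \<gamma> \<odot>\<^bsub>A_alg p l m q\<^esub> A_gen p l m q Gt"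

text \<open>
  The automorphism \<open>\<phi>\<^sub>\<alpha>\<^sub>,\<^sub>\<beta>\<^sub>,\<^sub>\<gamma>\<close>. The description is meaningful only if exactly one automorphism takes
  these values on the generators.
\<close>

definition scaling_aut ::
    "'k::field \<Rightarrow> 'k \<Rightarrow> 'k \<Rightarrow> 'k \<Rightarrow> 'k \<Rightarrow> 'k \<Rightarrow> 'k
      \<Rightarrow> (gen, 'k) free_alg set \<Rightarrow> (gen, 'k) free_alg set" where
  "scaling_aut p l m q \<alpha> \<beta> \<gamma> =
     (THE h. h \<in> carrier (algebra_AutoGroup (A_alg p l m q)) \<and> is_scaling p l m q \<alpha> \<beta> \<gamma> h)"

section \<open>The base field\<close>

definition is_root_of_unity :: "'k::field \<Rightarrow> bool" where
  "is_root_of_unity a \<longleftrightarrow> (\<exists>n>0. a ^ n = 1)"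

abbreviation mult_group :: "'k::field monoid" where
  "mult_group \<equiv> units_of ring_of_type_algebra"

end

theory Submission
  imports Defs "HOL-Library.Product_Plus" "HOL-Library.Product_Lexorder"
begin

text \<open>
  Put \<open>z = xy - yx = 1 + (p - 1)yx\<close>. The elements \<open>x, z, s, t\<close> commute with each other up to
  scalars, and \<open>y = (z - 1)x\<^sup>-\<^sup>1/(p - 1)\<close> once \<open>x\<close> is inverted. So the algebra maps to the quantum torus
  on \<open>x, z, s, t\<close>, which is the group algebra of \<open>\<int>\<^sup>4\<close> with product twisted by a bicharacter
  (\<open>realize\<close>). The map is injective, because the ordered monomials \<open>y\<^sup>i x\<^sup>j s\<^sup>a t\<^sup>b\<close> span the algebra
  and their images have distinct highest exponents (\<open>realize_eq_iff\<close>).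

  Rigidity comes from the normal elements, that is, the \<open>n \<noteq> 0\<close> with \<open>nA \<subseteq> An\<close>. If \<open>n e = g n\<close> for a
  monomial \<open>e\<close> of the torus, then comparing highest and lowest exponents shows that \<open>g\<close> is a
  scalar multiple of \<open>e\<close>. Hence a normal element commutes up to scalars with \<open>x, z, s, t\<close>, and
  since \<open>p\<close> and \<open>q\<close> are not roots of unity these scalars determine an exponent: \<open>n\<close> is a single
  monomial. The condition for \<open>y\<close> leaves only \<open>c z\<^sup>k s\<^sup>a t\<^sup>b\<close> (\<open>normal_imp_monomial\<close>).

  An automorphism permutes the normal elements, so on exponents it gives an automorphism of the
  monoid \<open>\<nat>\<^sup>3\<close>, a permutation of \<open>z, s, t\<close> up to scalars. The relations \<open>st = qts\<close>, \<open>zs = sz\<close>,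
  \<open>zt = tz\<close> exclude all but the identity (\<open>phi_normal_generators\<close>). Now \<open>z\<close> is fixed up to a
  scalar \<open>c\<close>, and commutation with \<open>z\<close> detects the degree in \<open>x\<close>, so the images of \<open>x\<close> and \<open>y\<close> have
  degrees \<open>1\<close> and \<open>-1\<close>. Their product is \<open>(cz - 1)/(p - 1)\<close>, and in the algebra the coefficient of
  \<open>x\<^sup>-\<^sup>1\<close> always vanishes at \<open>z = 1\<close>. Comparing exponents, \<open>x\<close> goes to a multiple of \<open>x\<close>; evaluating at
  \<open>z = 1\<close> gives \<open>c = 1\<close>, and \<open>y\<close> goes to the inverse multiple of \<open>y\<close> (\<open>phi_is_scaling\<close>).

  Conversely, rescaling words in the free algebra respects the relations
  (\<open>scaling_automorphism_exists\<close>), and an automorphism is determined by its values on the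
  generators, which also gives the group structure.
\<close>

section \<open>Finitely supported functions\<close>

abbreviation keys :: "('a \<Rightarrow>\<^sub>0 'b::zero) \<Rightarrow> 'a set" where "keys \<equiv> Poly_Mapping.keys"
abbreviation lookup :: "('a \<Rightarrow>\<^sub>0 'b::zero) \<Rightarrow> 'a \<Rightarrow> 'b" where "lookup \<equiv> Poly_Mapping.lookup"
abbreviation single :: "'a \<Rightarrow> 'b \<Rightarrow> 'a \<Rightarrow>\<^sub>0 'b::zero" where "single \<equiv> Poly_Mapping.single"

lemma poly_mapping_add_induct [case_names single add]:
  assumes single: "\<And>v a. P (single v a)"
    and add: "\<And>f g. P f \<Longrightarrow> P g \<Longrightarrow> P (f + g)"
  shows "P (f :: 'a \<Rightarrow>\<^sub>0 'b::ab_group_add)"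
proof (induction f rule: update_induct)
  case const
  show ?case using single[of undefined 0] by simp
next
  case (update f v c)
  have "Poly_Mapping.update v c f = f + single v c"
    using update(1) by (intro poly_mapping_eqI) (auto simp: lookup_update lookup_add lookup_single in_keys_iff when_def)
  then show ?case using add[OF update(3) single] by simp
qed

definition lin_ext :: "('a \<Rightarrow> 'b \<Rightarrow> 'c) \<Rightarrow> ('a \<Rightarrow>\<^sub>0 'b::zero) \<Rightarrow> 'c::comm_monoid_add" where
  "lin_ext h f = (\<Sum>v\<in>keys f. h v (lookup f v))"

lemma lin_ext_superset:
  assumes "finite A" "keys f \<subseteq> A" "\<And>v. h v 0 = 0"
  shows "lin_ext h f = (\<Sum>v\<in>A. h v (lookup f v))"
  unfolding lin_ext_def using assms by (intro sum.mono_neutral_left) (auto simp: in_keys_iff)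

lemma lin_ext_single: "h v 0 = 0 \<Longrightarrow> lin_ext h (single v a) = h v a"
  by (simp add: lin_ext_def)

lemma lin_ext_add:
  fixes h :: "'a \<Rightarrow> 'b::ab_group_add \<Rightarrow> 'c::ab_group_add"
  assumes "\<And>v a b. h v (a + b) = h v a + h v b"
  shows "lin_ext h (f + g) = lin_ext h f + lin_ext h g"
proof -
  have h0: "h v 0 = 0" for v using assms[of v 0 0] by simp
  let ?A = "keys f \<union> keys g"
  have "lin_ext h e = (\<Sum>v\<in>?A. h v (lookup e v))" if "keys e \<subseteq> ?A" for e
    using that h0 by (intro lin_ext_superset) auto
  then show ?thesis
    using keys_add[of f g] by (simp add: lookup_add assms sum.distrib)
qed

definition scale :: "'b::mult_zero \<Rightarrow> ('a \<Rightarrow>\<^sub>0 'b) \<Rightarrow> ('a \<Rightarrow>\<^sub>0 'b)" where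
  "scale c f = Poly_Mapping.map ((*) c) f"

lemma lookup_scale [simp]: "lookup (scale c f) v = c * lookup f v"
  by (auto simp: scale_def Poly_Mapping.map.rep_eq when_def)

lemma scale_single [simp]: "scale c (single v a) = single v (c * a)"
  by (intro poly_mapping_eqI) (simp add: lookup_single when_def)

lemma scale_add:
  fixes f g :: "'a \<Rightarrow>\<^sub>0 'b::ring"
  shows "scale c (f + g) = scale c f + scale c g"
  by (intro poly_mapping_eqI) (simp add: lookup_add ring_distribs)

lemma scale_add_left:
  fixes f :: "'a \<Rightarrow>\<^sub>0 'b::ring"
  shows "scale (c + d) f = scale c f + scale d f"
  by (intro poly_mapping_eqI) (simp add: lookup_add ring_distribs)

lemma scale_scale [simp]:
  fixes f :: "'a \<Rightarrow>\<^sub>0 'b::ring"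
  shows "scale c (scale d f) = scale (c * d) f"
  by (intro poly_mapping_eqI) (simp add: mult.assoc)

lemma scale_zero_left [simp]: "scale 0 f = 0"
  by (intro poly_mapping_eqI) simp

lemma scale_one [simp]: "scale (1::'b::ring_1) f = f"
  by (intro poly_mapping_eqI) simp

lemma scale_minus_one: "scale (-1::'b::ring_1) f = - f"
  by (intro poly_mapping_eqI) simp

lemma scale_diff:
  fixes f g :: "'a \<Rightarrow>\<^sub>0 'b::ring"
  shows "scale c (f - g) = scale c f - scale c g"
  by (intro poly_mapping_eqI) (simp add: lookup_minus ring_distribs)

lemma single_eq_0_iff: "single v c = 0 \<longleftrightarrow> c = 0"
  by (metis lookup_single_eq lookup_zero single_zero)

lemma scale_inverse_eq:
  fixes f g :: "'a \<Rightarrow>\<^sub>0 'b::field"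
  assumes "f = scale c g" "c \<noteq> 0"
  shows "g = scale (inverse c) f"
  using assms by simp

lemma poly_mapping_keys_singleton:
  assumes "keys f \<subseteq> {v}"
  shows "f = single v (lookup f v)"
  using assms by (intro poly_mapping_eqI) (auto simp: lookup_single when_def in_keys_iff)

text \<open>
  Leading exponents of elements of a group algebra are additive as soon as the group carries a
  translation invariant total order; on \<open>\<int>\<^sup>4\<close> the lexicographic order serves this purpose.
\<close>

instance prod :: (linordered_ab_group_add, linordered_ab_group_add) linordered_ab_group_add
  by standard (auto simp: less_eq_prod_def)

section \<open>Twisted group algebras of ordered groups\<close>

text \<open>
  The twist is bimultiplicative, hence a 2-cocycle, which is what makes the product with
  \<open>e\<^sub>u e\<^sub>v = tw u v \<cdot> e\<^sub>u\<^sub>+\<^sub>v\<close> on the basis associative.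
\<close>

locale twisted_group_algebra =
  fixes tw :: "'g::linordered_ab_group_add \<Rightarrow> 'g \<Rightarrow> 'k::field"
  assumes tw_nonzero [simp]: "tw u v \<noteq> 0"
    and tw_add_left: "tw (u + v) w = tw u w * tw v w"
    and tw_add_right: "tw u (v + w) = tw u v * tw u w"
begin

lemma tw_zero_left [simp]: "tw 0 v = 1"
  using tw_add_left[of 0 0 v] by simp

lemma tw_zero_right [simp]: "tw v 0 = 1"
  using tw_add_right[of v 0 0] by simp

definition tmul :: "('g \<Rightarrow>\<^sub>0 'k) \<Rightarrow> ('g \<Rightarrow>\<^sub>0 'k) \<Rightarrow> ('g \<Rightarrow>\<^sub>0 'k)" (infixl "\<star>" 70) where
  "f \<star> g = lin_ext (\<lambda>u a. lin_ext (\<lambda>v b. single (u + v) (a * b * tw u v)) g) f"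

lemma tmul_single:
  "single u a \<star> single v b = single (u + v) (a * b * tw u v)"
  by (simp add: tmul_def lin_ext_single lin_ext_def)

lemma tmul_add_right: "f \<star> (g + h) = f \<star> g + f \<star> h"
proof -
  have "lin_ext (\<lambda>v b. single (u + v) (a * b * tw u v)) (g + h) =
     lin_ext (\<lambda>v b. single (u + v) (a * b * tw u v)) g +
     lin_ext (\<lambda>v b. single (u + v) (a * b * tw u v)) h" for u a
    by (rule lin_ext_add) (simp add: single_add algebra_simps)
  then show ?thesis
    by (simp add: tmul_def lin_ext_def sum.distrib)
qed

lemma tmul_add_left: "(f + g) \<star> h = f \<star> h + g \<star> h"
  unfolding tmul_def
  by (rule lin_ext_add) (simp add: lin_ext_def ring_distribs single_add sum.distrib)

lemma tmul_zero [simp]: "0 \<star> f = 0" "f \<star> 0 = 0"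
  by (simp_all add: tmul_def lin_ext_def)

lemma tmul_minus: "(- f) \<star> g = - (f \<star> g)" "f \<star> (- g) = - (f \<star> g)"
  using tmul_add_left[of f "-f" g] tmul_add_right[of f g "-g"] by (simp_all add: eq_neg_iff_add_eq_0 add.commute)

lemma tmul_diff: "(f - g) \<star> h = f \<star> h - g \<star> h" "h \<star> (f - g) = h \<star> f - h \<star> g"
  by (simp_all add: diff_conv_add_uminus tmul_add_left tmul_add_right tmul_minus del: add_uminus_conv_diff)

lemma tmul_assoc: "f \<star> g \<star> h = f \<star> (g \<star> h)"
proof (induction f rule: poly_mapping_add_induct)
  case (single u a)
  show ?case
  proof (induction g rule: poly_mapping_add_induct)
    case (single v b)
    show ?case
    proof (induction h rule: poly_mapping_add_induct)
      case (single w c)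
      show ?case by (simp add: tmul_single tw_add_left tw_add_right algebra_simps)
    qed (simp add: tmul_add_right)
  qed (simp add: tmul_add_left tmul_add_right)
qed (simp add: tmul_add_left)

lemma tmul_one [simp]: "1 \<star> f = f" "f \<star> 1 = f"
  unfolding single_one[symmetric]
  by (induction f rule: poly_mapping_add_induct;
      simp add: tmul_single tmul_add_left tmul_add_right del: single_one)+

lemma tmul_scale: "scale c f \<star> g = scale c (f \<star> g)" "f \<star> scale c g = scale c (f \<star> g)"
proof -
  have "scale c f \<star> g = scale c (f \<star> g) \<and> f \<star> scale c g = scale c (f \<star> g)"
  proof (induction f rule: poly_mapping_add_induct)
    case (single u a)
    show ?case
      by (induction g rule: poly_mapping_add_induct)
         (simp_all add: tmul_single tmul_add_right scale_add mult_ac)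
  qed (simp add: tmul_add_left scale_add)
  then show "scale c f \<star> g = scale c (f \<star> g)" "f \<star> scale c g = scale c (f \<star> g)" by auto
qed

lemma lookup_tmul:
  "lookup (f \<star> g) w = (\<Sum>u\<in>keys f. \<Sum>v\<in>keys g. (lookup f u * lookup g v * tw u v when u + v = w))"
  by (simp add: tmul_def lin_ext_def lookup_sum lookup_single)

lemma keys_tmul:
  assumes "w \<in> keys (f \<star> g)"
  obtains u v where "u \<in> keys f" "v \<in> keys g" "w = u + v"
proof -
  have "lookup (f \<star> g) w \<noteq> 0" using assms by (simp add: in_keys_iff)
  then obtain u where u: "u \<in> keys f"
      "(\<Sum>v\<in>keys g. (lookup f u * lookup g v * tw u v when u + v = w)) \<noteq> 0"
    unfolding lookup_tmul by (rule sum.not_neutral_contains_not_neutral)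
  from u(2) obtain v where "v \<in> keys g" "(lookup f u * lookup g v * tw u v when u + v = w) \<noteq> 0"
    by (rule sum.not_neutral_contains_not_neutral)
  then show ?thesis using that u(1) by auto
qed

lemma add_mono_eq_imp_eq:
  fixes a b c d :: "'a::linordered_ab_group_add"
  assumes "a \<le> c" "b \<le> d" "a + b = c + d"
  shows "a = c \<and> b = d"
proof -
  have "a = c"
    using add_less_le_mono[of a c b d] assms by (cases "a < c") auto
  then show ?thesis using assms by simp
qed

text \<open>
  A sum of exponents that is attained only once suffers no cancellation. Both the two highest and
  the two lowest exponents of the factors have this property, which is the way in which the order
  on the group enters.
\<close>

lemma lookup_tmul_unique:
  assumes "u \<in> keys f" "v \<in> keys g"
    and uniq: "\<And>u' v'. u' \<in> keys f \<Longrightarrow> v' \<in> keys g \<Longrightarrow> u' + v' = u + v \<Longrightarrow> u' = u \<and> v' = v"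
  shows "lookup (f \<star> g) (u + v) = lookup f u * lookup g v * tw u v"
proof -
  have "lookup (f \<star> g) (u + v) =
      (\<Sum>u'\<in>keys f. \<Sum>v'\<in>keys g. if v' = v then (if u' = u then lookup f u * lookup g v * tw u v else 0) else 0)"
    unfolding lookup_tmul
  proof (intro sum.cong refl)
    fix u' v' assume "u' \<in> keys f" "v' \<in> keys g"
    then show "(lookup f u' * lookup g v' * tw u' v' when u' + v' = u + v) =
        (if v' = v then (if u' = u then lookup f u * lookup g v * tw u v else 0) else 0)"
    proof (cases "u' = u \<and> v' = v")
      case False
      moreover from this have "u' + v' \<noteq> u + v"
        using uniq[OF \<open>u' \<in> keys f\<close> \<open>v' \<in> keys g\<close>] by blast
      ultimately show ?thesis by auto
    qed simp
  qed
  also have "\<dots> = lookup f u * lookup g v * tw u v"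
    using assms(1,2) by (simp add: sum.delta)
  finally show ?thesis .
qed

lemma
  assumes "f \<noteq> 0" "g \<noteq> 0"
  shows Max_keys_tmul: "Max (keys (f \<star> g)) = Max (keys f) + Max (keys g)"
    and Min_keys_tmul: "Min (keys (f \<star> g)) = Min (keys f) + Min (keys g)"
    and tmul_nonzero: "f \<star> g \<noteq> 0"
proof -
  have ne: "keys f \<noteq> {}" "keys g \<noteq> {}" using assms by auto
  define u v where "u = Max (keys f)" and "v = Max (keys g)"
  have uv: "u \<in> keys f" "v \<in> keys g" using ne by (auto simp: u_def v_def)
  have le: "u' \<le> u" if "u' \<in> keys f" for u' using that by (simp add: u_def)
  have le': "v' \<le> v" if "v' \<in> keys g" for v' using that by (simp add: v_def)
  have "lookup (f \<star> g) (u + v) = lookup f u * lookup g v * tw u v"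
    by (rule lookup_tmul_unique[OF uv]) (rule add_mono_eq_imp_eq[OF le le'])
  then have mem: "u + v \<in> keys (f \<star> g)" using uv by (simp add: in_keys_iff)
  then show "f \<star> g \<noteq> 0" by auto
  show "Max (keys (f \<star> g)) = Max (keys f) + Max (keys g)"
    unfolding u_def[symmetric] v_def[symmetric]
  proof (rule Max_eqI[OF finite_keys _ mem])
    fix w assume "w \<in> keys (f \<star> g)"
    then obtain a b where "a \<in> keys f" "b \<in> keys g" "w = a + b" by (rule keys_tmul)
    then show "w \<le> u + v" using add_mono[OF le le'] by simp
  qed
  define u2 v2 where "u2 = Min (keys f)" and "v2 = Min (keys g)"
  have uv2: "u2 \<in> keys f" "v2 \<in> keys g" using ne by (auto simp: u2_def v2_def)
  have ge: "u2 \<le> u'" if "u' \<in> keys f" for u' using that by (simp add: u2_def)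
  have ge': "v2 \<le> v'" if "v' \<in> keys g" for v' using that by (simp add: v2_def)
  have "lookup (f \<star> g) (u2 + v2) = lookup f u2 * lookup g v2 * tw u2 v2"
    by (rule lookup_tmul_unique[OF uv2]) (drule add_mono_eq_imp_eq[OF ge ge' sym], simp_all)
  then have mem: "u2 + v2 \<in> keys (f \<star> g)" using uv2 by (simp add: in_keys_iff)
  show "Min (keys (f \<star> g)) = Min (keys f) + Min (keys g)"
    unfolding u2_def[symmetric] v2_def[symmetric]
  proof (rule Min_eqI[OF finite_keys _ mem])
    fix w assume "w \<in> keys (f \<star> g)"
    then obtain a b where "a \<in> keys f" "b \<in> keys g" "w = a + b" by (rule keys_tmul)
    then show "u2 + v2 \<le> w" using add_mono[OF ge ge'] by simp
  qed
qed

lemma lookup_tmul_single_right: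
  "lookup (f \<star> single e a) (u + e) = lookup f u * a * tw u e"
proof (induction f rule: poly_mapping_add_induct)
  case (single v b)
  show ?case by (auto simp: tmul_single lookup_single when_def)
qed (simp add: tmul_add_left lookup_add ring_distribs)

lemma lookup_tmul_single_left:
  "lookup (single e a \<star> f) (e + u) = a * lookup f u * tw e u"
proof (induction f rule: poly_mapping_add_induct)
  case (single v b)
  show ?case by (auto simp: tmul_single lookup_single when_def)
qed (simp add: tmul_add_right lookup_add ring_distribs)

lemma tmul_right_cancel:
  assumes "f \<star> h = g \<star> h" "h \<noteq> 0"
  shows "f = g"
  using tmul_nonzero[of "f - g" h] assms by (auto simp: tmul_diff)

text \<open>
  Highest and lowest exponent of \<open>a\<close> both equal \<open>e\<close>, because those of \<open>n\<close> cancel from the two sides.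
\<close>

lemma skew_commute_monomial:
  assumes n: "n \<noteq> 0" and eq: "n \<star> single e 1 = a \<star> n"
  obtains c where "a = single e c"
proof -
  have e: "single e (1::'k) \<noteq> 0" by (simp add: single_eq_0_iff)
  have a: "a \<noteq> 0"
  proof
    assume "a = 0"
    then show False using tmul_nonzero[OF n e] unfolding eq by simp
  qed
  have "Max (keys n) + e = Max (keys a) + Max (keys n)"
    using Max_keys_tmul[OF n e] Max_keys_tmul[OF a n] unfolding eq by simp
  then have M: "Max (keys a) = e" by (metis add.commute add_left_cancel)
  have "Min (keys n) + e = Min (keys a) + Min (keys n)"
    using Min_keys_tmul[OF n e] Min_keys_tmul[OF a n] unfolding eq by simp
  then have m: "Min (keys a) = e" by (metis add.commute add_left_cancel)
  have "keys a \<subseteq> {e}"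
  proof
    fix u assume "u \<in> keys a"
    then have "u \<le> e" "e \<le> u" using M m Max_ge[OF finite_keys] Min_le[OF finite_keys] by metis+
    then show "u \<in> {e}" by simp
  qed
  then show ?thesis by (rule that[OF poly_mapping_keys_singleton])
qed

text \<open>
  The basis vectors are eigenvectors for commutation with the basis vector \<open>e\<close>, so an element that
  commutes with \<open>e\<close> up to the scalar \<open>c\<close> is supported on one eigenspace.
\<close>

lemma skew_commute_keys:
  assumes "n \<star> single e 1 = single e c \<star> n" "u \<in> keys n"
  shows "tw u e = c * tw e u"
proof -
  have "lookup n u * tw u e = c * lookup n u * tw e u"
    using lookup_tmul_single_right[of n e 1 u] lookup_tmul_single_left[of e c n u]
    unfolding assms(1) add.commute[of e u] by (auto simp: mult_ac)
  then show ?thesis using assms(2) by (auto simp: in_keys_iff)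
qed

end

section \<open>Working in an algebra given by generators and relations\<close>

lemma ring_ring_of_type_algebra: "ring (ring_of_type_algebra :: 'a::ring_1 ring)"
proof -
  have "\<exists>y. y + x = 0 \<and> x + y = 0" for x :: 'a by (rule exI[of _ "- x"]) simp
  then show ?thesis
    by (intro ringI abelian_groupI monoidI) (auto simp: ring_of_type_algebra_def algebra_simps)
qed

lemma free_const_mult: "free_const c * f = scale c f"
  by (simp add: free_const_def scale_def mult_map_scale_conv_mult)

lemma scale_mult_left: "scale c f * g = scale c (f * (g :: ('g, 'k::comm_ring_1) free_alg))"
  by (simp flip: free_const_mult add: mult.assoc)

lemma scale_mult_right: "f * scale c g = scale c (f * (g :: ('g, 'k::comm_ring_1) free_alg))"
proof -
  have "f * free_const c = free_const c * f"
    unfolding free_const_def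
    by (induction f rule: poly_mapping_add_induct) (simp_all add: mult_single ring_distribs mult.commute)
  then show ?thesis by (simp flip: free_const_mult add: mult.assoc[symmetric])
qed

lemma relation_ideal_ideal: "ideal (relation_ideal R) ring_of_type_algebra"
  unfolding relation_ideal_def
  by (rule ring.genideal_ideal[OF ring_ring_of_type_algebra]) (simp add: ring_of_type_algebra_def)

lemma relation_ideal_superset: "R \<subseteq> relation_ideal R"
  unfolding relation_ideal_def
  by (rule ring.genideal_self[OF ring_ring_of_type_algebra]) (simp add: ring_of_type_algebra_def)

lemma relation_ideal_zero: "0 \<in> relation_ideal R"
  using additive_subgroup.zero_closed[OF ideal.axioms(1)[OF relation_ideal_ideal]]
  by (simp add: ring_of_type_algebra_def)

lemma relation_ideal_add: "f \<in> relation_ideal R \<Longrightarrow> g \<in> relation_ideal R \<Longrightarrow> f + g \<in> relation_ideal R"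
  using additive_subgroup.a_closed[OF ideal.axioms(1)[OF relation_ideal_ideal], of f R g]
  by (simp add: ring_of_type_algebra_def)

lemma relation_ideal_mult_left: "f \<in> relation_ideal R \<Longrightarrow> g * f \<in> relation_ideal R"
  using ideal.I_l_closed[OF relation_ideal_ideal, of f R g]
  by (simp add: ring_of_type_algebra_def)

lemma relation_ideal_mult_right: "f \<in> relation_ideal R \<Longrightarrow> f * g \<in> relation_ideal R"
  using ideal.I_r_closed[OF relation_ideal_ideal, of f R g]
  by (simp add: ring_of_type_algebra_def)

lemma relation_ideal_minus: "f \<in> relation_ideal R \<Longrightarrow> - f \<in> relation_ideal R"
  using relation_ideal_mult_left[of f R "-1"] by simp

text \<open>
  The tool for showing that a map on the free algebra factors through the relations.
\<close>

lemma relation_ideal_least: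
  assumes "R \<subseteq> J" "0 \<in> J" "\<And>f g. f \<in> J \<Longrightarrow> g \<in> J \<Longrightarrow> f + g \<in> J"
    and l: "\<And>f g. f \<in> J \<Longrightarrow> g * f \<in> J" and "\<And>f g. f \<in> J \<Longrightarrow> f * g \<in> J"
  shows "relation_ideal R \<subseteq> J"
proof -
  let ?F = "ring_of_type_algebra :: ('a, 'b) free_alg ring"
  interpret F: ring ?F by (rule ring_ring_of_type_algebra)
  have minus: "- f \<in> J" if "f \<in> J" for f using l[OF that, of "-1"] by simp
  have inv: "\<ominus>\<^bsub>?F\<^esub> f = - f" for f
    by (rule F.minus_equality) (simp_all add: ring_of_type_algebra_def)
  have "ideal J ?F"
  proof (rule idealI[OF ring_ring_of_type_algebra])
    show "subgroup J (add_monoid ?F)"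
      using assms minus inv[unfolded a_inv_def]
      by (intro subgroup.intro) (auto simp: ring_of_type_algebra_def)
  qed (use assms in \<open>simp_all add: ring_of_type_algebra_def\<close>)
  then show ?thesis
    unfolding relation_ideal_def by (rule F.genideal_minimal) (rule assms)
qed

definition cong_rel :: "('g, 'k::comm_ring_1) free_alg set \<Rightarrow> ('g, 'k) free_alg \<Rightarrow> ('g, 'k) free_alg \<Rightarrow> bool" where
  "cong_rel R f g \<longleftrightarrow> f - g \<in> relation_ideal R"

lemma cong_rel_refl [simp]: "cong_rel R f f"
  by (simp add: cong_rel_def relation_ideal_zero)

lemma cong_rel_sym: "cong_rel R f g \<Longrightarrow> cong_rel R g f"
  using relation_ideal_minus[of "f - g" R] by (simp add: cong_rel_def)

lemma cong_rel_trans [trans]: "cong_rel R f g \<Longrightarrow> cong_rel R g h \<Longrightarrow> cong_rel R f h"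
  using relation_ideal_add[of "f - g" R "g - h"] by (simp add: cong_rel_def)

lemma cong_rel_add: "cong_rel R f f' \<Longrightarrow> cong_rel R g g' \<Longrightarrow> cong_rel R (f + g) (f' + g')"
  using relation_ideal_add[of "f - f'" R "g - g'"] by (simp add: cong_rel_def algebra_simps)

lemma cong_rel_mult_left: "cong_rel R f f' \<Longrightarrow> cong_rel R (g * f) (g * f')"
  using relation_ideal_mult_left[of "f - f'" R g] by (simp add: cong_rel_def algebra_simps)

lemma cong_rel_mult_right: "cong_rel R f f' \<Longrightarrow> cong_rel R (f * g) (f' * g)"
  using relation_ideal_mult_right[of "f - f'" R g] by (simp add: cong_rel_def algebra_simps)

lemma cong_rel_scale: "cong_rel R f f' \<Longrightarrow> cong_rel R (scale c f) (scale c f')"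
  unfolding free_const_mult[symmetric] by (rule cong_rel_mult_left)

lemma cong_rel_relation: "f - g \<in> R \<Longrightarrow> cong_rel R f g"
  using relation_ideal_superset by (auto simp: cong_rel_def)

lemma cong_rel_skew_power:
  assumes "cong_rel R (u * v) (scale c (v * u))"
  shows "cong_rel R (u * v ^ n) (scale (c ^ n) (v ^ n * u))"
proof (induction n)
  case (Suc n)
  have "cong_rel R (u * v ^ Suc n) (scale c (v * u) * v ^ n)"
    using cong_rel_mult_right[OF assms, of "v ^ n"] by (simp add: mult.assoc)
  also have "scale c (v * u) * v ^ n = scale c (v * (u * v ^ n))"
    by (simp add: scale_mult_left mult.assoc)
  also have "cong_rel R \<dots> (scale c (v * scale (c ^ n) (v ^ n * u)))"
    by (intro cong_rel_scale cong_rel_mult_left Suc)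
  also have "\<dots> = scale (c ^ Suc n) (v ^ Suc n * u)"
    by (simp add: scale_mult_right mult.assoc)
  finally show ?case .
qed simp

lemma skew_power_move:
  assumes "cong_rel R (u * v) (scale c (v * u))"
  shows "cong_rel R (u * (v ^ n * w)) (scale (c ^ n) (v ^ n * (u * w)))"
  using cong_rel_mult_right[OF cong_rel_skew_power[OF assms, of n], of w]
  by (simp add: mult.assoc scale_mult_left)

lemma cong_rel_scale_inverse:
  fixes f g :: "('g, 'k::field) free_alg"
  assumes "cong_rel R f (scale c g)" "c \<noteq> 0"
  shows "cong_rel R g (scale (inverse c) f)"
  using cong_rel_sym[OF cong_rel_scale[OF assms(1), of "inverse c"]] assms(2) by simp

lemma presented_class_altdef: "presented_class R f = {g. cong_rel R g f}"
proof -
  have "g \<in> presented_class R f \<longleftrightarrow> cong_rel R g f" for g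
  proof -
    have "g \<in> presented_class R f \<longleftrightarrow> (\<exists>h\<in>relation_ideal R. g = h + f)"
      by (auto simp: presented_class_def a_r_coset_def r_coset_def ring_of_type_algebra_def)
    also have "\<dots> \<longleftrightarrow> g - f \<in> relation_ideal R"
      by (metis add_diff_cancel diff_add_cancel)
    finally show ?thesis by (simp add: cong_rel_def)
  qed
  then show ?thesis by blast
qed

lemma presented_class_eq_iff: "presented_class R f = presented_class R g \<longleftrightarrow> cong_rel R f g"
  unfolding presented_class_altdef using cong_rel_refl cong_rel_sym cong_rel_trans by blast

lemma carrier_presented: "carrier (presented_algebra R) = range (presented_class R)"
  by (auto simp: presented_algebra_def Let_def ring.defs FactRing_def A_RCOSETS_def'
        presented_class_def ring_of_type_algebra_def)

lemma mult_presented: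
  "presented_class R f \<otimes>\<^bsub>presented_algebra R\<^esub> presented_class R g = presented_class R (f * g)"
  using ideal.rcoset_mult_add[OF relation_ideal_ideal, of f g R]
  by (simp add: presented_algebra_def Let_def ring.defs FactRing_def presented_class_def ring_of_type_algebra_def)

lemma one_presented: "\<one>\<^bsub>presented_algebra R\<^esub> = presented_class R 1"
  by (simp add: presented_algebra_def Let_def ring.defs FactRing_def presented_class_def ring_of_type_algebra_def)

lemma add_presented:
  "presented_class R f \<oplus>\<^bsub>presented_algebra R\<^esub> presented_class R g = presented_class R (f + g)"
proof -
  interpret ideal "relation_ideal R" ring_of_type_algebra by (rule relation_ideal_ideal)
  show ?thesis
    using a_rcos_sum[of f g]
    by (simp add: presented_algebra_def Let_def ring.defs FactRing_def presented_class_def ring_of_type_algebra_def)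
qed

lemma smult_presented:
  "c \<odot>\<^bsub>presented_algebra R\<^esub> presented_class R f = presented_class R (scale c f)"
  using mult_presented[of R "free_const c" f]
  by (simp add: presented_algebra_def Let_def ring.defs free_const_mult)

lemmas presented_simps = carrier_presented mult_presented one_presented add_presented smult_presented

primrec unword :: "'g free_word \<Rightarrow> 'g list" where
  "unword (Word w) = w"

lemma unword_add: "unword (u + v) = unword u @ unword v"
  by (cases u; cases v) simp

lemma unword_zero [simp]: "unword 0 = []"
  by (simp add: zero_free_word_def)

text \<open>
  Words are built by left multiplication with generators, so a property of the free algebra that is
  compatible with linear combinations needs to be checked against one generator at a time.
\<close>

lemma free_alg_induct [case_names one var add scale]:
  fixes f :: "('g, 'k::comm_ring_1) free_alg"
  assumes "P 1" and var: "\<And>g f. P f \<Longrightarrow> P (free_var g * f)"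
    and "\<And>f g. P f \<Longrightarrow> P g \<Longrightarrow> P (f + g)" and "\<And>c f. P f \<Longrightarrow> P (scale c f)"
  shows "P f"
proof (induction f rule: poly_mapping_add_induct)
  case (single w a)
  have "P (single (Word ws) 1)" for ws
  proof (induction ws)
    case Nil
    then show ?case using \<open>P 1\<close> by (metis single_one zero_free_word_def)
  next
    case (Cons g ws)
    then show ?case using var[OF Cons, of g] by (simp add: free_var_def mult_single)
  qed
  then show ?case using assms(4)[of "single w 1" a] by (cases w) simp
qed (use assms in auto)

section \<open>The embedding into the quantum torus\<close>

type_synonym expo = "int \<times> int \<times> int \<times> int"

lemma power_int_eq_1_imp:
  assumes "\<not> is_root_of_unity (a::'k::field)" "a powi n = 1"
  shows "n = 0"
proof (cases n rule: int_cases2)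
  case (nonneg j)
  then show ?thesis using assms by (cases "j = 0") (auto simp: is_root_of_unity_def dest!: spec[of _ j])
next
  case (nonpos j)
  then have "a ^ j = 1" using assms(2) by (simp add: power_int_minus)
  then show ?thesis using assms nonpos by (cases "j = 0") (auto simp: is_root_of_unity_def dest!: spec[of _ j])
qed

lemma power_int_inj:
  assumes "\<not> is_root_of_unity (a::'k::field)" "a \<noteq> 0" "a powi n = a powi k"
  shows "n = k"
  using power_int_eq_1_imp[OF assms(1), of "n - k"] assms(2,3) by (simp add: power_int_diff)

locale quantum_parameters =
  fixes p q l m :: "'k::field"
  assumes p0 [simp]: "p \<noteq> 0" and q0 [simp]: "q \<noteq> 0" and l0 [simp]: "l \<noteq> 0" and m0 [simp]: "m \<noteq> 0"
    and p_root: "\<not> is_root_of_unity p" and q_root: "\<not> is_root_of_unity q"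
begin

lemma p1: "p - 1 \<noteq> 0"
  using p_root by (auto simp: is_root_of_unity_def intro: exI[of _ 1])

text \<open>
  The exponent \<open>(k, a, b, i)\<close> stands for the ordered monomial \<open>z\<^sup>k s\<^sup>a t\<^sup>b x\<^sup>i\<close>. The weight collects the
  scalars from reordering a product of two such monomials, using \<open>xz = pzx\<close>, \<open>xs = \<lambda>\<^sup>-\<^sup>1sx\<close>,
  \<open>xt = \<mu>\<^sup>-\<^sup>1tx\<close> and \<open>ts = q\<^sup>-\<^sup>1st\<close>. Putting \<open>z\<close> first in the order makes it dominate in the
  lexicographic order of exponents.
\<close>

definition tw :: "expo \<Rightarrow> expo \<Rightarrow> 'k" where
  "tw = (\<lambda>(k, a, b, i) (k', a', b', i').
     p powi (i * k') * l powi (- (i * a')) * m powi (- (i * b')) * q powi (- (b * a')))"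

sublocale twisted_group_algebra tw
proof
  fix u v w :: expo
  obtain k a b i where u: "u = (k, a, b, i)" by (cases u)
  obtain k' a' b' i' where v: "v = (k', a', b', i')" by (cases v)
  obtain k'' a'' b'' i'' where w: "w = (k'', a'', b'', i'')" by (cases w)
  show "tw u v \<noteq> 0" by (simp add: u v tw_def)
  show "tw (u + v) w = tw u w * tw v w"
    by (simp add: u v w tw_def algebra_simps power_int_add power_int_minus power_int_diff divide_simps)
  show "tw u (v + w) = tw u v * tw u w"
    by (simp add: u v w tw_def algebra_simps power_int_add power_int_minus power_int_diff divide_simps)
qed

abbreviation quantum_mult (infixl "\<star>" 70) where "f \<star> g \<equiv> tmul f g"

abbreviation "rels \<equiv> A_relations p l m q"

text \<open>
  The image of \<open>y\<close> is \<open>(z - 1)x\<^sup>-\<^sup>1/(p - 1)\<close>, forced by \<open>z = 1 + (p - 1)yx\<close>.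
\<close>

fun gen_image :: "gen \<Rightarrow> expo \<Rightarrow>\<^sub>0 'k" where
  "gen_image Gx = single (0, 0, 0, 1) 1"
| "gen_image Gy = scale (inverse (p - 1)) (single (1, 0, 0, -1) 1 - single (0, 0, 0, -1) 1)"
| "gen_image Gs = single (0, 1, 0, 0) 1"
| "gen_image Gt = single (0, 0, 1, 0) 1"

primrec word_image :: "gen list \<Rightarrow> expo \<Rightarrow>\<^sub>0 'k" where
  "word_image [] = 1"
| "word_image (g # ws) = gen_image g \<star> word_image ws"

lemma word_image_append: "word_image (u @ v) = word_image u \<star> word_image v"
  by (induction u) (simp_all add: tmul_assoc)

definition realize :: "(gen, 'k) free_alg \<Rightarrow> expo \<Rightarrow>\<^sub>0 'k" where
  "realize = lin_ext (\<lambda>w a. scale a (word_image (unword w)))"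

lemma realize_single: "realize (single w a) = scale a (word_image (unword w))"
  by (simp add: realize_def lin_ext_single)

lemma realize_add [simp]: "realize (f + g) = realize f + realize g"
  unfolding realize_def by (rule lin_ext_add) (simp add: scale_add_left)

lemma realize_scale [simp]: "realize (scale c f) = scale c (realize f)"
  by (induction f rule: poly_mapping_add_induct) (simp_all add: realize_single scale_add)

lemma realize_minus [simp]: "realize (- f) = - realize f"
  by (simp flip: scale_minus_one)

lemma realize_zero [simp]: "realize 0 = 0"
  by (simp add: realize_def lin_ext_def)

lemma realize_diff [simp]: "realize (f - g) = realize f - realize g"
  using realize_add[of f "- g"] by (simp del: realize_add)

lemma realize_sum: "realize (sum h A) = (\<Sum>x\<in>A. realize (h x))"
  by (induction A rule: infinite_finite_induct) simp_all

lemma realize_one [simp]: "realize 1 = 1"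
  using realize_single[of 0 1] by simp

lemma realize_mult [simp]: "realize (f * g) = realize f \<star> realize g"
proof (induction f rule: poly_mapping_add_induct)
  case (single u a)
  show ?case
    by (induction g rule: poly_mapping_add_induct)
       (simp_all add: mult_single realize_single unword_add word_image_append tmul_scale
          ring_distribs tmul_add_right mult.commute)
qed (simp add: ring_distribs tmul_add_left)

lemma realize_var [simp]: "realize (free_var g) = gen_image g"
  by (simp add: free_var_def realize_single)

lemma tw_apply: "tw (k, a, b, i) (k', a', b', i') =
    p powi (i * k') * l powi (- (i * a')) * m powi (- (i * b')) * q powi (- (b * a'))"
  by (simp add: tw_def)

lemma single_one_expo: "single (0, 0, 0, 0) (1::'k) = 1"
  by (simp flip: zero_prod_def)

lemma image_yx:
  "gen_image Gy \<star> gen_image Gx = scale (inverse (p - 1)) (single (1, 0, 0, 0) 1 - 1)"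
  by (simp only: gen_image.simps tmul_scale tmul_diff tmul_single tw_apply add_Pair)
     (simp add: single_one_expo)

lemma image_xy:
  "gen_image Gx \<star> gen_image Gy = scale (inverse (p - 1)) (single (1, 0, 0, 0) p - 1)"
  by (simp only: gen_image.simps tmul_scale tmul_diff tmul_single tw_apply add_Pair)
     (simp add: single_one_expo)

lemma image_relation_xy: "gen_image Gx \<star> gen_image Gy - scale p (gen_image Gy \<star> gen_image Gx) = 1"
proof -
  have c: "inverse (p - 1) * p - inverse (p - 1) = 1"
    using p1 by (metis left_inverse mult_1_right right_diff_distrib)
  have "gen_image Gx \<star> gen_image Gy - scale p (gen_image Gy \<star> gen_image Gx) =
      scale (inverse (p - 1) * p - inverse (p - 1)) 1"
    unfolding image_xy image_yx
    by (intro poly_mapping_eqI) (simp add: lookup_minus lookup_single lookup_one when_def algebra_simps)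
  then show ?thesis by (simp only: c scale_one)
qed

lemma skew_gen_images:
  "gen_image Gs \<star> gen_image Gt = scale q (gen_image Gt \<star> gen_image Gs)"
  "gen_image Gs \<star> gen_image Gx = scale l (gen_image Gx \<star> gen_image Gs)"
  "gen_image Gs \<star> gen_image Gy = scale (inverse l) (gen_image Gy \<star> gen_image Gs)"
  "gen_image Gt \<star> gen_image Gx = scale m (gen_image Gx \<star> gen_image Gt)"
  "gen_image Gt \<star> gen_image Gy = scale (inverse m) (gen_image Gy \<star> gen_image Gt)"
  by (simp_all add: tmul_scale tmul_diff tmul_single tw_apply power_int_minus scale_diff mult.commute)
    (simp_all add: mult.assoc[symmetric])

lemma realize_relations: "f \<in> rels \<Longrightarrow> realize f = 0"
  using image_relation_xy skew_gen_images
  unfolding A_relations_def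
  by (auto simp: free_const_mult scale_mult_left simp del: gen_image.simps)

lemma realize_cong: "cong_rel rels f g \<Longrightarrow> realize f = realize g"
proof -
  assume "cong_rel rels f g"
  moreover have "relation_ideal rels \<subseteq> {h. realize h = 0}"
    by (rule relation_ideal_least) (auto simp: realize_relations)
  ultimately show ?thesis by (auto simp: cong_rel_def)
qed

section \<open>The Poincare-Birkhoff-Witt basis\<close>

abbreviation "gx \<equiv> (free_var Gx :: (gen, 'k) free_alg)"
abbreviation "gy \<equiv> (free_var Gy :: (gen, 'k) free_alg)"
abbreviation "gs \<equiv> (free_var Gs :: (gen, 'k) free_alg)"
abbreviation "gt \<equiv> (free_var Gt :: (gen, 'k) free_alg)"

lemma relation_congs:
  "cong_rel rels (gx * gy) (scale p (gy * gx) + 1)"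
  "cong_rel rels (gs * gt) (scale q (gt * gs))"
  "cong_rel rels (gs * gx) (scale l (gx * gs))"
  "cong_rel rels (gs * gy) (scale (inverse l) (gy * gs))"
  "cong_rel rels (gt * gx) (scale m (gx * gt))"
  "cong_rel rels (gt * gy) (scale (inverse m) (gy * gt))"
  by (rule cong_rel_relation; simp add: A_relations_def free_const_mult scale_mult_left algebra_simps)+

text \<open>
  The constant is the \<open>p\<close>-integer \<open>1 + p + \<dots> + p\<^sup>n\<close>.
\<close>

lemma x_times_y_power:
  "\<exists>c. cong_rel rels (gx * gy ^ Suc n) (scale (p ^ Suc n) (gy ^ Suc n * gx) + scale c (gy ^ n))"
proof (induction n)
  case 0
  show ?case using relation_congs(1) by (intro exI[of _ 1]) simp
next
  case (Suc n)
  then obtain c where "cong_rel rels (gx * gy ^ Suc n) (scale (p ^ Suc n) (gy ^ Suc n * gx) + scale c (gy ^ n))"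
    by blast
  then have "cong_rel rels (gx * gy ^ Suc n * gy) ((scale (p ^ Suc n) (gy ^ Suc n * gx) + scale c (gy ^ n)) * gy)"
    by (rule cong_rel_mult_right)
  also have "(scale (p ^ Suc n) (gy ^ Suc n * gx) + scale c (gy ^ n)) * gy
      = scale (p ^ Suc n) (gy ^ Suc n * (gx * gy)) + scale c (gy ^ Suc n)"
    by (simp only: ring_distribs scale_mult_left mult.assoc power_Suc2[of gy n])
  also have "cong_rel rels \<dots>
      (scale (p ^ Suc n) (gy ^ Suc n * (scale p (gy * gx) + 1)) + scale c (gy ^ Suc n))"
    by (intro cong_rel_add cong_rel_scale cong_rel_mult_left relation_congs cong_rel_refl)
  also have "\<dots> = scale (p ^ Suc (Suc n)) (gy ^ Suc (Suc n) * gx) + scale (p ^ Suc n + c) (gy ^ Suc n)"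
    by (simp only: ring_distribs scale_mult_right scale_add scale_scale scale_add_left mult_1_right
          power_Suc2[of gy "Suc n"] power_Suc2[of p "Suc n"] mult.assoc add.assoc)
  finally show ?case by (auto simp only: power_Suc2[of gy "Suc n"] mult.assoc)
qed

definition pbw :: "nat \<times> nat \<times> nat \<times> nat \<Rightarrow> (gen, 'k) free_alg" where
  "pbw = (\<lambda>(i, j, a, b). gy ^ i * gx ^ j * gs ^ a * gt ^ b)"

definition pbw_sum :: "(nat \<times> nat \<times> nat \<times> nat \<Rightarrow>\<^sub>0 'k) \<Rightarrow> (gen, 'k) free_alg" where
  "pbw_sum = lin_ext (\<lambda>v a. scale a (pbw v))"

lemma pbw_sum_single: "pbw_sum (single v a) = scale a (pbw v)"
  by (simp add: pbw_sum_def lin_ext_single)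

lemma pbw_sum_add: "pbw_sum (c + d) = pbw_sum c + pbw_sum d"
  unfolding pbw_sum_def by (rule lin_ext_add) (simp add: scale_add_left)

lemma pbw_sum_scale: "pbw_sum (scale a c) = scale a (pbw_sum c)"
  by (induction c rule: poly_mapping_add_induct) (simp_all add: pbw_sum_single pbw_sum_add scale_add)

definition spanned :: "(gen, 'k) free_alg \<Rightarrow> bool" where
  "spanned f \<longleftrightarrow> (\<exists>c. cong_rel rels f (pbw_sum c))"

lemma spanned_cong: "cong_rel rels f g \<Longrightarrow> spanned g \<Longrightarrow> spanned f"
  unfolding spanned_def using cong_rel_trans by blast

lemma spanned_add: "spanned f \<Longrightarrow> spanned g \<Longrightarrow> spanned (f + g)"
  unfolding spanned_def by (metis cong_rel_add pbw_sum_add)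

lemma spanned_scale: "spanned f \<Longrightarrow> spanned (scale c f)"
  unfolding spanned_def by (metis cong_rel_scale pbw_sum_scale)

lemma spanned_pbw: "spanned (gy ^ i * gx ^ j * gs ^ a * gt ^ b)"
  unfolding spanned_def
  by (rule exI[of _ "single (i, j, a, b) 1"]) (simp add: pbw_sum_single pbw_def)

text \<open>
  A generator is moved to the right through the powers that precede it in the order \<open>y, x, s, t\<close>.
  Only \<open>x\<close> meeting a power of \<open>y\<close> produces a second term.
\<close>

lemma spanned_gen_pbw: "spanned (free_var g * (gy ^ i * gx ^ j * gs ^ a * gt ^ b))"
proof (cases g)
  case Gx
  show ?thesis
  proof (cases i)
    case 0
    then show ?thesis using spanned_pbw[of 0 "Suc j" a b] by (simp add: Gx mult.assoc)
  next
    case (Suc n)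
    let ?w = "gx ^ j * gs ^ a * gt ^ b"
    obtain c where "cong_rel rels (gx * gy ^ Suc n) (scale (p ^ Suc n) (gy ^ Suc n * gx) + scale c (gy ^ n))"
      using x_times_y_power by blast
    from cong_rel_mult_right[OF this, of ?w]
    have "cong_rel rels (free_var g * (gy ^ i * gx ^ j * gs ^ a * gt ^ b))
       (scale (p ^ Suc n) (gy ^ Suc n * gx ^ Suc j * gs ^ a * gt ^ b) + scale c (gy ^ n * gx ^ j * gs ^ a * gt ^ b))"
      unfolding Gx Suc by (simp only: ring_distribs scale_mult_left mult.assoc power_Suc[of gx])
    then show ?thesis
      by (rule spanned_cong) (intro spanned_add spanned_scale spanned_pbw)
  qed
next
  case Gy
  then show ?thesis using spanned_pbw[of "Suc i" j a b] by (simp add: mult.assoc)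
next
  case Gs
  let ?w = "gs ^ a * gt ^ b"
  have "cong_rel rels (gs * (gy ^ i * (gx ^ j * ?w))) (scale (inverse l ^ i) (gy ^ i * (gs * (gx ^ j * ?w))))"
    by (rule skew_power_move[OF relation_congs(4)])
  also have "cong_rel rels \<dots> (scale (inverse l ^ i) (gy ^ i * scale (l ^ j) (gx ^ j * (gs * ?w))))"
    by (intro cong_rel_scale cong_rel_mult_left skew_power_move relation_congs(3))
  finally have "cong_rel rels (free_var g * (gy ^ i * gx ^ j * gs ^ a * gt ^ b))
      (scale (inverse l ^ i * l ^ j) (gy ^ i * gx ^ j * gs ^ Suc a * gt ^ b))"
    by (simp add: Gs mult.assoc scale_mult_right)
  then show ?thesis by (rule spanned_cong) (intro spanned_scale spanned_pbw)
next
  case Gt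
  let ?w = "gs ^ a * gt ^ b"
  have ts: "cong_rel rels (gt * gs) (scale (inverse q) (gs * gt))"
    by (rule cong_rel_scale_inverse[OF relation_congs(2) q0])
  have "cong_rel rels (gt * (gy ^ i * (gx ^ j * ?w))) (scale (inverse m ^ i) (gy ^ i * (gt * (gx ^ j * ?w))))"
    by (rule skew_power_move[OF relation_congs(6)])
  also have "cong_rel rels \<dots> (scale (inverse m ^ i) (gy ^ i * scale (m ^ j) (gx ^ j * (gt * ?w))))"
    by (intro cong_rel_scale cong_rel_mult_left skew_power_move relation_congs(5))
  also have "cong_rel rels \<dots> (scale (inverse m ^ i) (gy ^ i * scale (m ^ j) (gx ^ j *
      scale (inverse q ^ a) (gs ^ a * (gt * gt ^ b)))))"
    by (intro cong_rel_scale cong_rel_mult_left skew_power_move ts)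
  finally have "cong_rel rels (free_var g * (gy ^ i * gx ^ j * gs ^ a * gt ^ b))
      (scale (inverse m ^ i * m ^ j * inverse q ^ a) (gy ^ i * gx ^ j * gs ^ a * gt ^ Suc b))"
    by (simp add: Gt mult.assoc scale_mult_right)
  then show ?thesis by (rule spanned_cong) (intro spanned_scale spanned_pbw)
qed

lemma spanned_gen_mult: "spanned f \<Longrightarrow> spanned (free_var g * f)"
proof -
  assume "spanned f"
  then obtain c where c: "cong_rel rels f (pbw_sum c)" by (auto simp: spanned_def)
  have "spanned (free_var g * pbw_sum c)"
  proof (induction c rule: poly_mapping_add_induct)
    case (single v a)
    then show ?case
      using spanned_gen_pbw by (cases v) (auto simp: pbw_sum_single pbw_def scale_mult_right intro: spanned_scale)
  qed (simp add: pbw_sum_add ring_distribs spanned_add)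
  then show ?thesis using spanned_cong cong_rel_mult_left[OF c] by blast
qed

lemma pbw_spanning: "spanned f"
proof (induction f rule: free_alg_induct)
  case one
  show ?case using spanned_pbw[of 0 0 0 0] by simp
qed (auto intro: spanned_add spanned_scale spanned_gen_mult)

lemma Max_keys_realize_power:
  assumes "realize u \<noteq> 0" "d 0 = 0" "\<And>n. d (Suc n) = Max (keys (realize u)) + d n"
  shows "realize (u ^ n) \<noteq> 0 \<and> Max (keys (realize (u ^ n))) = d n"
proof (induction n)
  case 0
  show ?case using assms(2) by simp
next
  case (Suc n)
  then show ?case using assms by (simp add: tmul_nonzero Max_keys_tmul)
qed

lemma keys_image_y: "keys (gen_image Gy) = {(1, 0, 0, -1), (0, 0, 0, -1)}"
  using p1 by (auto simp: in_keys_iff lookup_minus lookup_single when_def split: if_splits)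

text \<open>
  The highest exponents of the images of \<open>y, x, s, t\<close> are linearly independent, so distinct ordered
  monomials have distinct highest exponents.
\<close>

lemma Max_keys_pbw:
  "realize (pbw (i, j, a, b)) \<noteq> 0 \<and>
   Max (keys (realize (pbw (i, j, a, b)))) = (int i, int a, int b, int j - int i)"
proof -
  have y: "realize (gy ^ i) \<noteq> 0 \<and> Max (keys (realize (gy ^ i))) = (int i, 0, 0, - int i)"
  proof (rule Max_keys_realize_power)
    show "realize gy \<noteq> 0" using keys_image_y unfolding realize_var by (metis insert_not_empty keys_zero)
  qed (simp_all add: zero_prod_def keys_image_y del: gen_image.simps)
  have x: "realize (gx ^ j) \<noteq> 0 \<and> Max (keys (realize (gx ^ j))) = (0, 0, 0, int j)"
    by (rule Max_keys_realize_power) (simp_all add: zero_prod_def single_eq_0_iff)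
  have s: "realize (gs ^ a) \<noteq> 0 \<and> Max (keys (realize (gs ^ a))) = (0, int a, 0, 0)"
    by (rule Max_keys_realize_power) (simp_all add: zero_prod_def single_eq_0_iff)
  have t: "realize (gt ^ b) \<noteq> 0 \<and> Max (keys (realize (gt ^ b))) = (0, 0, int b, 0)"
    by (rule Max_keys_realize_power) (simp_all add: zero_prod_def single_eq_0_iff)
  from y x s t show ?thesis by (simp add: pbw_def tmul_nonzero Max_keys_tmul)
qed

text \<open>
  In a nontrivial combination, the largest of the highest exponents belongs to one ordered monomial
  only and survives.
\<close>

lemma realize_pbw_sum_eq_0:
  assumes "realize (pbw_sum c) = 0"
  shows "c = 0"
proof (rule ccontr)
  assume "c \<noteq> 0"
  define L where "L v = Max (keys (realize (pbw v)))" for v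
  have inj: "inj L" by (auto simp: inj_def L_def Max_keys_pbw)
  define M where "M = Max (L ` keys c)"
  have "M \<in> L ` keys c" using \<open>c \<noteq> 0\<close> unfolding M_def by (intro Max_in) auto
  then obtain v where v: "v \<in> keys c" "M = L v" by blast
  have zero: "lookup (realize (pbw u)) M = 0" if "u \<in> keys c" "u \<noteq> v" for u
  proof (rule ccontr)
    assume "lookup (realize (pbw u)) M \<noteq> 0"
    then have "M \<le> L u" unfolding L_def by (intro Max_ge) (simp_all add: in_keys_iff)
    moreover have "L u \<le> M" using that(1) by (simp add: M_def)
    ultimately show False using injD[OF inj] v(2) that(2) by fastforce
  qed
  have nz: "lookup (realize (pbw v)) M \<noteq> 0"
  proof -
    obtain i j a b where ij: "v = (i, j, a, b)" by (cases v)
    have "keys (realize (pbw v)) \<noteq> {}" using Max_keys_pbw by (simp add: ij)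
    then have "L v \<in> keys (realize (pbw v))" unfolding L_def by (intro Max_in) auto
    then show ?thesis by (simp add: v(2) in_keys_iff)
  qed
  have "realize (pbw_sum c) = (\<Sum>u\<in>keys c. scale (lookup c u) (realize (pbw u)))"
    by (simp add: pbw_sum_def lin_ext_def realize_sum)
  then have "0 = (\<Sum>u\<in>keys c. lookup c u * lookup (realize (pbw u)) M)"
    using assms by (metis (no_types, lifting) lookup_sum lookup_scale lookup_zero sum.cong)
  also have "\<dots> = (\<Sum>u\<in>{v}. lookup c u * lookup (realize (pbw u)) M)"
    using v(1) zero by (intro sum.mono_neutral_right) auto
  finally show False using nz v(1) by (simp add: in_keys_iff)
qed

text \<open>
  The algebra embeds into the quantum torus: an element of the kernel is congruent to a combination
  of ordered monomials, and that combination is trivial.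
\<close>

lemma realize_eq_iff: "realize f = realize g \<longleftrightarrow> cong_rel rels f g"
proof
  assume eq: "realize f = realize g"
  obtain c where c: "cong_rel rels (f - g) (pbw_sum c)"
    using pbw_spanning unfolding spanned_def by blast
  then have "realize (pbw_sum c) = 0" using realize_cong[OF c] eq by simp
  then have "c = 0" by (rule realize_pbw_sum_eq_0)
  then show "cong_rel rels f g" using c by (simp add: cong_rel_def pbw_sum_def lin_ext_def)
qed (rule realize_cong)

section \<open>The image of the algebra in the quantum torus\<close>

definition img :: "(expo \<Rightarrow>\<^sub>0 'k) set" where
  "img = range realize"

lemma img_mult: "f \<in> img \<Longrightarrow> g \<in> img \<Longrightarrow> f \<star> g \<in> img"
  by (auto simp: img_def simp flip: realize_mult)

lemma img_add: "f \<in> img \<Longrightarrow> g \<in> img \<Longrightarrow> f + g \<in> img"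
  by (auto simp: img_def simp flip: realize_add)

lemma img_scale: "f \<in> img \<Longrightarrow> scale c f \<in> img"
  by (auto simp: img_def simp flip: realize_scale)

lemma img_one: "1 \<in> img"
  by (auto simp: img_def simp flip: realize_one)

lemma img_gen: "gen_image g \<in> img"
  unfolding img_def by (rule range_eqI[of _ _ "free_var g"]) simp

lemma img_keys_nonneg:
  assumes "f \<in> img" "(k, a, b, i) \<in> keys f"
  shows "0 \<le> k \<and> 0 \<le> a \<and> 0 \<le> b"
proof -
  obtain F where "f = realize F" using assms(1) by (auto simp: img_def)
  moreover have "\<forall>(k, a, b, i) \<in> keys (realize F). 0 \<le> k \<and> 0 \<le> a \<and> 0 \<le> b" for F
  proof (induction F rule: free_alg_induct)
    case one
    show ?case by (simp add: zero_prod_def)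
  next
    case (var g f)
    have "0 \<le> k \<and> 0 \<le> a \<and> 0 \<le> b" if "(k, a, b, i) \<in> keys (gen_image g)" for k a b i
      using that keys_image_y by (cases g) (auto simp del: gen_image.simps(2))
    then show ?case using var by (fastforce elim!: keys_tmul)
  next
    case (add f g)
    then show ?case using keys_add[of "realize f" "realize g"] by auto
  next
    case (scale c f)
    then show ?case by (auto simp: in_keys_iff)
  qed
  ultimately show ?thesis using assms(2) by fast
qed

text \<open>
  The coefficient of \<open>s\<^sup>a t\<^sup>b x\<^sup>i\<close>, a Laurent polynomial in \<open>z\<close> standing on the left, evaluated at
  \<open>z = 1\<close>.
\<close>

definition eval_z1 :: "int \<Rightarrow> int \<Rightarrow> int \<Rightarrow> (expo \<Rightarrow>\<^sub>0 'k) \<Rightarrow> 'k" where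
  "eval_z1 a b i = lin_ext (\<lambda>(k, a', b', i') c. if (a', b', i') = (a, b, i) then c else 0)"

lemma eval_z1_single: "eval_z1 a b i (single (k, a', b', i') c) = (if (a', b', i') = (a, b, i) then c else 0)"
  by (simp add: eval_z1_def lin_ext_single)

lemma eval_z1_add: "eval_z1 a b i (f + g) = eval_z1 a b i f + eval_z1 a b i g"
  unfolding eval_z1_def by (rule lin_ext_add) auto

lemma eval_z1_scale: "eval_z1 a b i (scale c f) = c * eval_z1 a b i f"
proof (induction f rule: poly_mapping_add_induct)
  case (single v d)
  then show ?case by (cases v) (simp add: eval_z1_single)
qed (simp add: eval_z1_add scale_add ring_distribs)

lemma eval_z1_diff: "eval_z1 a b i (f - g) = eval_z1 a b i f - eval_z1 a b i g"
  using eval_z1_add[of a b i f "scale (-1) g"] by (simp add: eval_z1_scale) (simp add: scale_minus_one)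

lemma eval_z1_image_y_mult: "eval_z1 a b i (gen_image Gy \<star> g) = 0"
proof (induction g rule: poly_mapping_add_induct)
  case (single v c)
  obtain k a b i where "v = (k, a, b, i)" by (cases v)
  then show ?case by (simp add: tmul_scale tmul_diff tmul_single tw_apply eval_z1_scale eval_z1_diff eval_z1_single)
qed (simp add: tmul_add_right eval_z1_add del: gen_image.simps)

text \<open>
  An ordered monomial of negative degree in \<open>x\<close> begins with \<open>y\<close>, which contributes the factor \<open>z - 1\<close>
  on the left. In particular no negative power of \<open>x\<close> alone lies in the image.
\<close>

lemma img_eval_z1_neg:
  assumes "f \<in> img" "i < 0"
  shows "eval_z1 a b i f = 0"
proof -
  have nonneg: "\<forall>(k, a, b, i) \<in> keys (realize (gx ^ j * gs ^ a' * gt ^ b')). 0 \<le> i" for j a' b'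
  proof -
    define D where "D F \<longleftrightarrow> (\<forall>(k, a, b, i) \<in> keys (realize F). 0 \<le> i)" for F
    have mult: "D F \<Longrightarrow> D G \<Longrightarrow> D (F * G)" for F G
      unfolding D_def by (fastforce elim!: keys_tmul)
    have one: "D 1" by (simp add: D_def zero_prod_def)
    have power: "D F \<Longrightarrow> D (F ^ n)" for F n by (induction n) (auto intro: one mult)
    have "D gx" "D gs" "D gt" by (simp_all add: D_def)
    then show ?thesis unfolding D_def[symmetric] by (intro mult power)
  qed
  obtain F where F: "f = realize F" using assms(1) by (auto simp: img_def)
  obtain c where "cong_rel rels F (pbw_sum c)" using pbw_spanning unfolding spanned_def by blast
  then have "f = realize (pbw_sum c)" using F realize_cong by simp
  moreover have "eval_z1 a b i (realize (pbw_sum c)) = 0"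
  proof (induction c rule: poly_mapping_add_induct)
    case (single v d)
    obtain i' j a' b' where v: "v = (i', j, a', b')" by (cases v)
    have "eval_z1 a b i (realize (pbw v)) = 0"
    proof (cases i')
      case 0
      then have "pbw v = gx ^ j * gs ^ a' * gt ^ b'" by (simp add: v pbw_def)
      then show ?thesis using nonneg[of j a' b'] assms(2)
        unfolding eval_z1_def lin_ext_def by (intro sum.neutral) auto
    next
      case (Suc n)
      then have "realize (pbw v) = gen_image Gy \<star> realize (gy ^ n * (gx ^ j * gs ^ a' * gt ^ b'))"
        by (simp add: v pbw_def mult.assoc tmul_assoc del: gen_image.simps)
      then show ?thesis by (simp only: eval_z1_image_y_mult)
    qed
    then show ?case by (simp add: pbw_sum_single eval_z1_scale)
  qed (simp add: pbw_sum_add eval_z1_add)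
  ultimately show ?thesis by simp
qed

lemma img_vanish:
  assumes "f \<in> img" "keys f \<subseteq> {(1, 0, 0, -1), (0, 0, 0, -1)}"
  shows "lookup f (1, 0, 0, -1) + lookup f (0, 0, 0, -1) = 0"
proof -
  have "eval_z1 0 0 (-1) f = lookup f (1, 0, 0, -1) + lookup f (0, 0, 0, -1)"
    unfolding eval_z1_def by (subst lin_ext_superset[OF _ assms(2)]) auto
  then show ?thesis using img_eval_z1_neg[OF assms(1), of "-1" 0 0] by simp
qed

abbreviation Z :: "expo \<Rightarrow>\<^sub>0 'k" where
  "Z \<equiv> single (1, 0, 0, 0) 1"

lemma Z_eq: "Z = 1 + scale (p - 1) (gen_image Gy \<star> gen_image Gx)"
  unfolding image_yx using p1 by simp

lemma img_Z: "Z \<in> img"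
  unfolding Z_eq by (intro img_add img_one img_scale img_mult img_gen)

text \<open>
  Monomials \<open>z\<^sup>k s\<^sup>a t\<^sup>b\<close> are built up from the left in the normal order, so that no scalars arise.
\<close>

lemma monomial_step:
  "single (int (Suc k), int a, int b, 0) 1 = Z \<star> single (int k, int a, int b, 0) 1"
  "single (0, int (Suc a), int b, 0) 1 = gen_image Gs \<star> single (0, int a, int b, 0) 1"
  "single (0, 0, int (Suc b), 0) 1 = gen_image Gt \<star> single (0, 0, int b, 0) 1"
  by (simp_all add: tmul_single tw_apply)

lemma monomial_induct [case_names one Z S T]:
  assumes "P 0 0 0" "\<And>k a b. P k a b \<Longrightarrow> P (Suc k) a b" "\<And>a b. P 0 a b \<Longrightarrow> P 0 (Suc a) b"
    "\<And>b. P 0 0 b \<Longrightarrow> P 0 0 (Suc b)"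
  shows "P (k::nat) (a::nat) (b::nat)"
proof -
  have "P 0 0 b" by (induction b) (auto intro: assms)
  then have "P 0 a b" by (induction a) (auto intro: assms)
  then show ?thesis by (induction k) (auto intro: assms)
qed

lemma img_monomial: "single (int k, int a, int b, 0) 1 \<in> img"
proof (induction k a b rule: monomial_induct)
  case one
  show ?case using img_one by (simp add: single_one_expo)
next
  case (Z k a b)
  then show ?case unfolding monomial_step by (intro img_mult img_Z)
next
  case (S a b)
  then show ?case using img_mult[OF img_gen[of Gs]] by (simp only: monomial_step of_nat_0)
next
  case (T b)
  then show ?case using img_mult[OF img_gen[of Gt]] by (simp only: monomial_step of_nat_0)
qed

section \<open>Normal elements\<close>

text \<open>
  Normality in the form \<open>nA \<subseteq> An\<close>, a notion that every automorphism respects.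
\<close>

definition normal_element :: "(expo \<Rightarrow>\<^sub>0 'k) \<Rightarrow> bool" where
  "normal_element n \<longleftrightarrow> n \<in> img \<and> n \<noteq> 0 \<and> (\<forall>f\<in>img. \<exists>g\<in>img. n \<star> f = g \<star> n)"

text \<open>
  All exponents of a normal element have the same weights against \<open>z, s, t, x\<close>. The weight against
  \<open>z\<close> is a power of \<open>p\<close> that gives the degree in \<open>x\<close>. Once this is known, the powers of \<open>q\<close> in the
  weights against \<open>s\<close> and \<open>t\<close> give the degrees in \<open>t\<close> and \<open>s\<close>, and finally the weight against \<open>x\<close> gives
  the degree in \<open>z\<close>.
\<close>

lemma normal_keys_unique:
  assumes n: "normal_element n" and u: "u \<in> keys n" and v: "v \<in> keys n"
  shows "u = v"
proof -
  have n0: "n \<noteq> 0" using n by (simp add: normal_element_def)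
  have weight: "tw u e * tw e v = tw v e * tw e u" if e: "single e 1 \<in> img" for e
  proof -
    obtain g where "n \<star> single e 1 = g \<star> n" using n e by (auto simp: normal_element_def)
    moreover from this obtain c where "g = single e c"
      using skew_commute_monomial[OF n0] by blast
    ultimately have "tw w e = c * tw e w" if "w \<in> keys n" for w
      using skew_commute_keys that by blast
    then show ?thesis using u v by simp
  qed
  obtain k a b i where u': "u = (k, a, b, i)" by (cases u)
  obtain k' a' b' i' where v': "v = (k', a', b', i')" by (cases v)
  have "p powi i = p powi i'"
    using weight[OF img_Z] by (simp add: u' v' tw_apply)
  then have i: "i = i'" by (rule power_int_inj[OF p_root p0])
  have "q powi b' = q powi b"
    using weight[of "(0, 1, 0, 0)"] img_gen[of Gs] by (simp add: u' v' tw_apply i power_int_minus)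
  then have b: "b = b'" using power_int_inj[OF q_root q0] by metis
  have "q powi a' = q powi a"
    using weight[of "(0, 0, 1, 0)"] img_gen[of Gt] by (simp add: u' v' tw_apply i power_int_minus)
  then have a: "a = a'" using power_int_inj[OF q_root q0] by metis
  have "p powi k' = p powi k"
    using weight[of "(0, 0, 0, 1)"] img_gen[of Gx] by (simp add: u' v' tw_apply a b power_int_minus)
  then have "k = k'" using power_int_inj[OF p_root p0] by metis
  then show ?thesis by (simp add: u' v' i a b)
qed

text \<open>
  It remains to exclude powers of \<open>x\<close>. Negative ones are not in the image, by evaluation at \<open>z = 1\<close>.
  For \<open>i > 0\<close>, conjugating \<open>y\<close> with \<open>x\<^sup>i\<close> turns \<open>z - 1\<close> into \<open>p\<^sup>i z - 1\<close>, which does not vanish at \<open>z = 1\<close>,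
  so that \<open>n y = g n\<close> has no solution \<open>g\<close> in the image.
\<close>

lemma normal_imp_monomial:
  assumes n: "normal_element n"
  obtains k a b :: nat and c where "c \<noteq> 0" "n = single (int k, int a, int b, 0) c"
proof -
  have nM: "n \<in> img" and "n \<noteq> 0" using n by (simp_all add: normal_element_def)
  then obtain v where v: "v \<in> keys n" by (metis keys_eq_empty equals0I)
  obtain k a b i where v': "v = (k, a, b, i)" by (cases v)
  define c where "c = lookup n v"
  have c0: "c \<noteq> 0" using v by (simp add: c_def in_keys_iff)
  have "keys n \<subseteq> {v}" using normal_keys_unique[OF n _ v] by blast
  then have nv: "n = single v c" unfolding c_def by (rule poly_mapping_keys_singleton)
  have "\<not> i < 0" using img_eval_z1_neg[OF nM, of i a b] c0 by (auto simp: nv v' eval_z1_single)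
  \<comment> \<open>The only candidate for \<open>g\<close> is the conjugate \<open>n y n\<^sup>-\<^sup>1\<close>, computed here coefficient by coefficient.\<close>
  obtain g where g: "g \<in> img" "n \<star> gen_image Gy = g \<star> n" using n img_gen[of Gy] by (auto simp: normal_element_def)
  have lookup_g: "lookup g u = lookup (gen_image Gy) u * tw v u / tw u v" for u
  proof -
    have "lookup g u * c * tw u v = c * lookup (gen_image Gy) u * tw v u"
      using lookup_tmul_single_right[of g v c u] lookup_tmul_single_left[of v c "gen_image Gy" u]
      by (simp add: g(2)[unfolded nv, symmetric] add.commute del: gen_image.simps)
    then have "lookup g u * tw u v = lookup (gen_image Gy) u * tw v u"
      using c0 by (simp add: mult_ac del: gen_image.simps)
    then show ?thesis by (simp add: nonzero_eq_divide_eq del: gen_image.simps)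
  qed
  have "keys g \<subseteq> keys (gen_image Gy)" by (auto simp: in_keys_iff lookup_g simp del: gen_image.simps)
  then have "lookup g (1, 0, 0, -1) + lookup g (0, 0, 0, -1) = 0"
    using g(1) by (intro img_vanish) (simp_all only: keys_image_y)
  moreover have "lookup g (1, 0, 0, -1) = inverse (p - 1) * p powi i * tw v (0, 0, 0, -1) / tw (0, 0, 0, -1) v"
    unfolding lookup_g by (simp add: v' tw_apply lookup_minus lookup_single)
  moreover have "lookup g (0, 0, 0, -1) = - (inverse (p - 1) * tw v (0, 0, 0, -1) / tw (0, 0, 0, -1) v)"
    unfolding lookup_g by (simp add: lookup_minus lookup_single)
  ultimately have "p powi i = 1" using p1 by (simp add: field_simps)
  then have "i = 0" by (rule power_int_eq_1_imp[OF p_root])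
  moreover have "0 \<le> k" "0 \<le> a" "0 \<le> b" using img_keys_nonneg[OF nM] v by (auto simp: v')
  ultimately show ?thesis using that[of c "nat k" "nat a" "nat b"] c0 by (simp add: nv v')
qed

text \<open>
  The set of \<open>f\<close> with \<open>n f \<in> A n\<close> is a subalgebra, so it contains everything once it contains the
  generators.
\<close>

lemma normal_if_skew_commutes:
  assumes n: "n \<in> img" "n \<noteq> 0" and skew: "\<And>g. \<exists>c. n \<star> gen_image g = scale c (gen_image g \<star> n)"
  shows "normal_element n"
proof -
  have "\<exists>G. n \<star> realize F = realize G \<star> n" for F
  proof (induction F rule: free_alg_induct)
    case one
    show ?case by (rule exI[of _ 1]) simp
  next
    case (var g f)
    then obtain G where G: "n \<star> realize f = realize G \<star> n" by blast
    obtain c where "n \<star> gen_image g = scale c (gen_image g \<star> n)" using skew by blast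
    then have "n \<star> (gen_image g \<star> realize f) = scale c (gen_image g) \<star> realize G \<star> n"
      by (simp only: tmul_assoc[symmetric]) (simp only: tmul_scale tmul_assoc G)
    then show ?case by (intro exI[of _ "scale c (free_var g) * G"]) simp
  next
    case (add f g)
    then obtain F G where "n \<star> realize f = realize F \<star> n" "n \<star> realize g = realize G \<star> n" by blast
    then show ?case by (intro exI[of _ "F + G"]) (simp add: tmul_add_left tmul_add_right)
  next
    case (scale c f)
    then obtain F where "n \<star> realize f = realize F \<star> n" by blast
    then show ?case by (intro exI[of _ "scale c F"]) (simp add: tmul_scale)
  qed
  then show ?thesis using n unfolding normal_element_def img_def by blast
qed

lemma normal_S: "normal_element (gen_image Gs)"
proof (rule normal_if_skew_commutes)
  fix g
  show "\<exists>c. gen_image Gs \<star> gen_image g = scale c (gen_image g \<star> gen_image Gs)"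
    using skew_gen_images by (cases g) (force intro: exI[of _ 1] simp del: gen_image.simps)+
qed (use img_gen[of Gs] in \<open>simp_all add: single_eq_0_iff\<close>)

lemma normal_T: "normal_element (gen_image Gt)"
proof (rule normal_if_skew_commutes)
  fix g
  show "\<exists>c. gen_image Gt \<star> gen_image g = scale c (gen_image g \<star> gen_image Gt)"
    using skew_gen_images(2-) scale_inverse_eq[OF skew_gen_images(1) q0]
    by (cases g) (force intro: exI[of _ 1] simp del: gen_image.simps)+
qed (use img_gen[of Gt] in \<open>simp_all add: single_eq_0_iff\<close>)

lemma skew_Z:
  "gen_image Gx \<star> Z = scale p (Z \<star> gen_image Gx)"
  "gen_image Gy \<star> Z = scale (inverse p) (Z \<star> gen_image Gy)"
  "gen_image Gs \<star> Z = Z \<star> gen_image Gs"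
  "gen_image Gt \<star> Z = Z \<star> gen_image Gt"
  by (simp_all add: tmul_scale tmul_diff tmul_single tw_apply power_int_minus scale_diff mult.commute)

lemma normal_Z: "normal_element Z"
proof (rule normal_if_skew_commutes)
  fix g
  show "\<exists>c. Z \<star> gen_image g = scale c (gen_image g \<star> Z)"
    using scale_inverse_eq[OF skew_Z(1)] scale_inverse_eq[OF skew_Z(2)] skew_Z(3,4)
    by (cases g) (force intro: exI[of _ 1] simp del: gen_image.simps)+
qed (use img_Z in \<open>simp_all add: single_eq_0_iff\<close>)

end

text \<open>
  The columns are the exponents of the images of \<open>s\<close>, \<open>t\<close> and \<open>z\<close>. The last three assumptions say that these
  vectors generate the monoid \<open>\<nat>\<^sup>3\<close>, whose basis vectors are indecomposable, and \<open>det\<close> and \<open>comm\<close> are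
  what remains of \<open>st = qts\<close>, \<open>zs = sz\<close> and \<open>zt = tz\<close>. Together they force \<open>z\<close> to go to a power of \<open>z\<close>,
  after which the matrix of \<open>s, t\<close> is a nonnegative integral matrix with nonnegative inverse and
  determinant \<open>1\<close>.
\<close>

lemma exponent_matrix_is_identity:
  fixes k1 k2 k3 a1 a2 a3 b1 b2 b3 :: int
  assumes nonneg: "0 \<le> k1" "0 \<le> k2" "0 \<le> k3" "0 \<le> a1" "0 \<le> a2" "0 \<le> b1" "0 \<le> b2"
    and det: "a1 * b2 - b1 * a2 = 1" and comm: "b3 * a1 = b1 * a3" "b3 * a2 = b2 * a3"
    and S: "\<exists>(k::nat) (a::nat) (b::nat). int k * k3 + int a * k1 + int b * k2 = 0 \<and>
      int k * a3 + int a * a1 + int b * a2 = 1 \<and> int k * b3 + int a * b1 + int b * b2 = 0"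
    and T: "\<exists>(k::nat) (a::nat) (b::nat). int k * k3 + int a * k1 + int b * k2 = 0 \<and>
      int k * a3 + int a * a1 + int b * a2 = 0 \<and> int k * b3 + int a * b1 + int b * b2 = 1"
    and Z: "\<exists>(k::nat) (a::nat) (b::nat). int k * k3 + int a * k1 + int b * k2 = 1 \<and>
      int k * a3 + int a * a1 + int b * a2 = 0 \<and> int k * b3 + int a * b1 + int b * b2 = 0"
  shows "(k1, a1, b1) = (0, 1, 0) \<and> (k2, a2, b2) = (0, 0, 1) \<and> (k3, a3, b3) = (1, 0, 0)"
proof -
  have "a3 * (a1 * b2 - b1 * a2) = a1 * (b2 * a3) - a2 * (b1 * a3)"
    by (simp add: right_diff_distrib mult_ac)
  also have "\<dots> = 0" unfolding comm[symmetric] by (simp add: mult_ac)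
  finally have a3: "a3 * (a1 * b2 - b1 * a2) = 0" .
  have "b3 * (a1 * b2 - b1 * a2) = b2 * (b3 * a1) - b1 * (b3 * a2)"
    by (simp add: right_diff_distrib mult_ac)
  also have "\<dots> = 0" unfolding comm by (simp add: mult_ac)
  finally have "b3 * (a1 * b2 - b1 * a2) = 0" .
  with a3 have zero: "a3 = 0" "b3 = 0" unfolding det by simp_all
  have "0 < a1 * b2" using det mult_nonneg_nonneg[OF nonneg(6,5)] by linarith
  then have pos: "0 < a1" "0 < b2" using nonneg by (simp_all add: zero_less_mult_iff)
  have zero_if: "x = 0" if "int n * x + int n' * y = 0" "0 < int n" "0 \<le> x" "0 \<le> y" for x y n n'
  proof -
    have "int n * x = 0"
      using that(1) mult_nonneg_nonneg[of "int n" x] mult_nonneg_nonneg[of "int n'" y] that(3,4) by linarith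
    then show ?thesis using that(2) by simp
  qed
  have zero_coeff: "n = 0" if "int n * x + int n' * y = 0" "0 < x" "0 \<le> y" for x y n n'
    using zero_if[OF that(1) _ _ that(3)] that(2) by (cases "n = 0") auto
  have one: "int n = 1 \<and> x = 1" if "int n * x = 1" for n x
    using that pos_zmult_eq_1_iff[of "int n" x] by (cases "n = 0") auto
  obtain k a b :: nat where Z': "int k * k3 + int a * k1 + int b * k2 = 1"
      "int a * a1 + int b * a2 = 0" "int b * b2 + int a * b1 = 0"
    using Z unfolding zero by (auto simp: add.commute)
  have "a = 0" by (rule zero_coeff[OF Z'(2)]) (use nonneg pos in auto)
  moreover have "b = 0" by (rule zero_coeff[OF Z'(3)]) (use nonneg pos in auto)
  ultimately have k3: "k3 = 1" using Z'(1) one[of k k3] by simp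
  obtain k a b :: nat where S': "int k * 1 + int a * k1 + int b * k2 = 0"
      "int a * a1 + int b * a2 = 1" "int b * b2 + int a * b1 = 0"
    using S unfolding zero k3 by (auto simp: add.commute)
  have b: "b = 0" by (rule zero_coeff[OF S'(3)]) (use nonneg pos in auto)
  then have a: "int a = 1" "a1 = 1" using one[of a a1] S'(2) by simp_all
  have "b1 = 0" using S'(3) a b by simp
  moreover have "k1 = 0" using S'(1) a b nonneg by simp
  moreover obtain k a b :: nat where T': "int k * 1 + int a * k1 + int b * k2 = 0"
      "int a * a1 + int b * a2 = 0" "int b * b2 + int a * b1 = 1"
    using T unfolding zero k3 by (auto simp: add.commute)
  have a': "a = 0" by (rule zero_coeff[OF T'(2)]) (use nonneg pos in auto)
  then have b': "int b = 1" "b2 = 1" using one[of b b2] T'(3) by simp_all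
  have "a2 = 0" using T'(2) a' b' by simp
  moreover have "k2 = 0" using T'(1) a' b' nonneg by simp
  ultimately show ?thesis using zero k3 a b' by simp
qed

section \<open>Automorphisms of the image\<close>

text \<open>
  Automorphisms are studied on the image in the torus, where exponents are available.
\<close>

locale image_automorphism = quantum_parameters p q l m
  for p q l m :: "'k::field" +
  fixes \<phi> :: "(expo \<Rightarrow>\<^sub>0 'k) \<Rightarrow> (expo \<Rightarrow>\<^sub>0 'k)"
  assumes bij: "bij_betw \<phi> img img"
    and hom_add: "f \<in> img \<Longrightarrow> g \<in> img \<Longrightarrow> \<phi> (f + g) = \<phi> f + \<phi> g"
    and hom_mult: "f \<in> img \<Longrightarrow> g \<in> img \<Longrightarrow> \<phi> (tmul f g) = tmul (\<phi> f) (\<phi> g)"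
    and hom_scale: "f \<in> img \<Longrightarrow> \<phi> (scale c f) = scale c (\<phi> f)"
begin

lemma phi_closed: "f \<in> img \<Longrightarrow> \<phi> f \<in> img"
  using bij bij_betwE by blast

lemma phi_surj: "g \<in> img \<Longrightarrow> \<exists>f\<in>img. g = \<phi> f"
  using bij by (auto simp: bij_betw_def)

lemma phi_inj: "f \<in> img \<Longrightarrow> g \<in> img \<Longrightarrow> \<phi> f = \<phi> g \<longleftrightarrow> f = g"
  using bij by (auto simp: bij_betw_def inj_on_def)

lemma phi_zero: "\<phi> 0 = 0"
  using hom_scale[OF img_one, of 0] by simp

lemma phi_one: "\<phi> 1 = 1"
proof -
  obtain u where u: "u \<in> img" "1 = \<phi> u" using phi_surj[OF img_one] by blast
  have "\<phi> 1 \<star> \<phi> u = \<phi> u" using hom_mult[OF img_one u(1)] by simp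
  then show ?thesis by (simp flip: u(2))
qed

lemma img_zero: "0 \<in> img"
  using img_scale[OF img_one, of 0] by simp

lemma normal_phi_iff:
  assumes f: "f \<in> img"
  shows "normal_element (\<phi> f) \<longleftrightarrow> normal_element f"
proof -
  have "\<phi> f \<star> \<phi> g = \<phi> h \<star> \<phi> f \<longleftrightarrow> f \<star> g = h \<star> f" if "g \<in> img" "h \<in> img" for g h
    using that f by (simp flip: hom_mult add: phi_inj img_mult)
  moreover have "\<phi> ` img = img" using bij by (simp add: bij_betw_def)
  ultimately have "(\<forall>g\<in>img. \<exists>h\<in>img. \<phi> f \<star> g = h \<star> \<phi> f) \<longleftrightarrow> (\<forall>g\<in>img. \<exists>h\<in>img. f \<star> g = h \<star> f)"
    by (smt (verit, best) image_iff)
  moreover have "\<phi> f = 0 \<longleftrightarrow> f = 0" using phi_inj[OF f img_zero] by (simp add: phi_zero)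
  ultimately show ?thesis using f phi_closed by (simp add: normal_element_def)
qed

text \<open>
  The generators \<open>s, t, z\<close> are normal, so their images are monomials, and every normal element is the
  image of a monomial in \<open>z, s, t\<close>, so the three exponents generate all of \<open>\<nat>\<^sup>3\<close>.
\<close>

lemma phi_normal_generators:
  obtains cs ct cz where "cs \<noteq> 0" "ct \<noteq> 0" "cz \<noteq> 0"
    "\<phi> (gen_image Gs) = scale cs (gen_image Gs)"
    "\<phi> (gen_image Gt) = scale ct (gen_image Gt)"
    "\<phi> Z = scale cz Z"
proof -
  obtain k1 a1 b1 :: nat and c1 where 1: "c1 \<noteq> 0" "\<phi> (gen_image Gs) = single (int k1, int a1, int b1, 0) c1"
    using normal_imp_monomial normal_S normal_phi_iff img_gen by metis
  obtain k2 a2 b2 :: nat and c2 where 2: "c2 \<noteq> 0" "\<phi> (gen_image Gt) = single (int k2, int a2, int b2, 0) c2"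
    using normal_imp_monomial normal_T normal_phi_iff img_gen by metis
  obtain k3 a3 b3 :: nat and c3 where 3: "c3 \<noteq> 0" "\<phi> Z = single (int k3, int a3, int b3, 0) c3"
    using normal_imp_monomial normal_Z normal_phi_iff img_Z by metis
  \<comment> \<open>The exponent of the image of \<open>z\<^sup>k s\<^sup>a t\<^sup>b\<close>.\<close>
  define E where "E k a b = (int k * int k3 + int a * int k1 + int b * int k2,
      int k * int a3 + int a * int a1 + int b * int a2,
      int k * int b3 + int a * int b1 + int b * int b2, 0::int)" for k a b
  have phi_monomial: "\<exists>c. \<phi> (single (int k, int a, int b, 0) 1) = single (E k a b) c" for k a b
  proof (induction k a b rule: monomial_induct)
    case one
    show ?case using phi_one by (auto simp: E_def single_one_expo intro!: exI[of _ 1])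
  next
    case (Z k a b)
    then obtain c where c: "\<phi> (single (int k, int a, int b, 0) 1) = single (E k a b) c" by blast
    have "\<phi> (single (int (Suc k), int a, int b, 0) 1) =
        single ((int k3, int a3, int b3, 0) + E k a b) (c3 * c * tw (int k3, int a3, int b3, 0) (E k a b))"
      unfolding monomial_step(1) hom_mult[OF img_Z img_monomial] 3(2) c by (rule tmul_single)
    moreover have "(int k3, int a3, int b3, 0) + E k a b = E (Suc k) a b"
      by (simp add: E_def algebra_simps)
    ultimately show ?case by metis
  next
    case (S a b)
    then obtain c where "\<phi> (single (int 0, int a, int b, 0) 1) = single (E 0 a b) c" by blast
    then have "\<phi> (single (int 0, int (Suc a), int b, 0) 1) =
        single ((int k1, int a1, int b1, 0) + E 0 a b) (c1 * c * tw (int k1, int a1, int b1, 0) (E 0 a b))"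
      using hom_mult[OF img_gen[of Gs] img_monomial[of 0 a b]]
      by (simp only: monomial_step 1 tmul_single of_nat_0)
    moreover have "(int k1, int a1, int b1, 0) + E 0 a b = E 0 (Suc a) b"
      by (simp add: E_def algebra_simps)
    ultimately show ?case by metis
  next
    case (T b)
    then obtain c where "\<phi> (single (int 0, int 0, int b, 0) 1) = single (E 0 0 b) c" by blast
    then have "\<phi> (single (int 0, int 0, int (Suc b), 0) 1) =
        single ((int k2, int a2, int b2, 0) + E 0 0 b) (c2 * c * tw (int k2, int a2, int b2, 0) (E 0 0 b))"
      using hom_mult[OF img_gen[of Gt] img_monomial[of 0 0 b]]
      by (simp only: monomial_step 2 tmul_single of_nat_0)
    moreover have "(int k2, int a2, int b2, 0) + E 0 0 b = E 0 0 (Suc b)"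
      by (simp add: E_def algebra_simps)
    ultimately show ?case by metis
  qed
  have hit: "\<exists>k a b. E k a b = v" if v: "normal_element (single v 1)" for v
  proof -
    have "single v 1 \<in> img" using v by (simp add: normal_element_def)
    then obtain u where u: "u \<in> img" "single v 1 = \<phi> u" using phi_surj by blast
    then have "normal_element u" using normal_phi_iff v by simp
    then obtain k a b :: nat and c where "u = single (int k, int a, int b, 0) c"
      by (rule normal_imp_monomial)
    then have u': "u = scale c (single (int k, int a, int b, 0) 1)" by simp
    obtain d where "\<phi> (single (int k, int a, int b, 0) 1) = single (E k a b) d"
      using phi_monomial by blast
    moreover have "single v 1 = scale c (\<phi> (single (int k, int a, int b, 0) 1))"
      using u(2) by (simp only: u' hom_scale img_monomial)
    ultimately have "single v 1 = single (E k a b) (c * d)" by simp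
    then have "keys (single v (1::'k)) = keys (single (E k a b) (c * d))" by simp
    then show ?thesis by (auto split: if_splits)
  qed
  \<comment> \<open>The image of \<open>st = qts\<close>, read off at the only exponent that occurs on either side.\<close>
  have "q powi (int a1 * int b2 - int b1 * int a2) = q powi 1"
  proof -
    have "\<phi> (gen_image Gs) \<star> \<phi> (gen_image Gt) = scale q (\<phi> (gen_image Gt) \<star> \<phi> (gen_image Gs))"
      using arg_cong[OF skew_gen_images(1), of \<phi>]
      by (simp only: hom_mult hom_scale img_mult img_gen)
    from arg_cong[OF this, of "\<lambda>f. lookup f (int (k1 + k2), int (a1 + a2), int (b1 + b2), 0)"]
    have "c1 * c2 * q powi (- (int b1 * int a2)) = q * (c1 * c2 * q powi (- (int b2 * int a1)))"
      unfolding 1 2 by (simp add: tmul_single tw_apply lookup_single mult_ac add_ac)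
    then have "q powi (- (int b1 * int a2)) = q * q powi (- (int b2 * int a1))"
      using 1(1) 2(1) by simp
    then show ?thesis by (simp add: power_int_diff power_int_minus field_simps)
  qed
  then have det: "int a1 * int b2 - int b1 * int a2 = 1"
    by (rule power_int_inj[OF q_root q0])
  have commutes: "int b3 * int a = int b * int a3"
    if "\<phi> f = single (int k, int a, int b, 0) c" "c \<noteq> 0" "f \<in> img" "f \<star> Z = Z \<star> f" for f k a b c
  proof -
    have "\<phi> f \<star> \<phi> Z = \<phi> Z \<star> \<phi> f"
      using that(3,4) by (simp flip: hom_mult add: img_Z)
    from arg_cong[OF this, of "\<lambda>f. lookup f (int (k + k3), int (a + a3), int (b + b3), 0)"]
    have "c * c3 * q powi (- (int b * int a3)) = c * c3 * q powi (- (int b3 * int a))"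
      unfolding 3 that(1) by (simp add: tmul_single tw_apply lookup_single mult_ac add_ac)
    then have "- (int b * int a3) = - (int b3 * int a)"
      using that(2) 3(1) by (intro power_int_inj[OF q_root q0]) simp
    then show ?thesis by simp
  qed
  have "(int k1, int a1, int b1) = (0, 1, 0) \<and> (int k2, int a2, int b2) = (0, 0, 1) \<and>
      (int k3, int a3, int b3) = (1, 0, 0)"
  proof (rule exponent_matrix_is_identity[OF _ _ _ _ _ _ _ det])
    show "int b3 * int a1 = int b1 * int a3" by (rule commutes[OF 1(2,1) img_gen skew_Z(3)])
    show "int b3 * int a2 = int b2 * int a3" by (rule commutes[OF 2(2,1) img_gen skew_Z(4)])
  qed (use hit[of "(0, 1, 0, 0)"] hit[of "(0, 0, 1, 0)"] hit[of "(1, 0, 0, 0)"] normal_S normal_T normal_Z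
        in \<open>auto simp: E_def\<close>)
  then show ?thesis using that[OF 1(1) 2(1) 3(1)] 1(2) 2(2) 3(2) by simp
qed

text \<open>
  Commutation with \<open>z\<close> shows that the images of \<open>x\<close> and \<open>y\<close> are homogeneous of degrees \<open>1\<close> and \<open>-1\<close> in
  \<open>x\<close>. The highest exponent of their product is that of \<open>z\<close>, so it lies entirely in one factor.
  It cannot lie in the image of \<open>x\<close>, since then the image of \<open>y\<close> would be a multiple of \<open>x\<^sup>-\<^sup>1\<close>, whose
  coefficient does not vanish at \<open>z = 1\<close>.
\<close>

theorem phi_is_scaling:
  obtains \<alpha> \<beta> \<gamma> where "\<alpha> \<noteq> 0" "\<beta> \<noteq> 0" "\<gamma> \<noteq> 0"
    "\<phi> (gen_image Gx) = scale \<alpha> (gen_image Gx)" "\<phi> (gen_image Gy) = scale (inverse \<alpha>) (gen_image Gy)"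
    "\<phi> (gen_image Gs) = scale \<beta> (gen_image Gs)" "\<phi> (gen_image Gt) = scale \<gamma> (gen_image Gt)"
proof -
  obtain \<beta> \<gamma> c where nz: "\<beta> \<noteq> 0" "\<gamma> \<noteq> 0" "c \<noteq> 0"
    and st: "\<phi> (gen_image Gs) = scale \<beta> (gen_image Gs)" "\<phi> (gen_image Gt) = scale \<gamma> (gen_image Gt)"
    and phi_Z: "\<phi> Z = scale c Z"
    by (rule phi_normal_generators)
  define PX where "PX = \<phi> (gen_image Gx)"
  define PY where "PY = \<phi> (gen_image Gy)"
  have XM: "PX \<in> img" and YM: "PY \<in> img" by (simp_all only: PX_def PY_def phi_closed img_gen)
  have degree: "i = n"
    if u: "(k, a, b, i) \<in> keys (\<phi> f)" and f: "f \<in> img" "f \<star> Z = scale (p powi n) (Z \<star> f)" for f k a b i n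
  proof -
    have "\<phi> f \<star> \<phi> Z = scale (p powi n) (\<phi> Z \<star> \<phi> f)"
      using arg_cong[OF f(2), of \<phi>] f(1) by (simp only: hom_mult hom_scale img_mult img_Z)
    then have "scale c (\<phi> f \<star> Z) = scale c (scale (p powi n) (Z \<star> \<phi> f))"
      unfolding phi_Z tmul_scale by (simp only: scale_scale mult.commute)
    then have "scale (inverse c) (scale c (\<phi> f \<star> Z)) = scale (inverse c) (scale c (scale (p powi n) (Z \<star> \<phi> f)))"
      by simp
    then have "\<phi> f \<star> Z = scale (p powi n) Z \<star> \<phi> f"
      using nz(3) by (simp add: tmul_scale mult.assoc[symmetric] del: scale_single)
    then have "\<phi> f \<star> Z = single (1, 0, 0, 0) (p powi n) \<star> \<phi> f" by simp
    from skew_commute_keys[OF this u] have "p powi i = p powi n"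
      by (simp add: tw_apply)
    then show ?thesis by (rule power_int_inj[OF p_root p0])
  qed
  have degX: "i = 1" if "(k, a, b, i) \<in> keys PX" for k a b i
    using degree[OF that[unfolded PX_def] img_gen, of 1] skew_Z(1) by (simp del: gen_image.simps)
  have degY: "i = -1" if "(k, a, b, i) \<in> keys PY" for k a b i
    using degree[OF that[unfolded PY_def] img_gen, of "-1"] skew_Z(2)
    by (simp add: power_int_minus del: gen_image.simps)
  \<comment> \<open>The image of \<open>yx = (z - 1)/(p - 1)\<close>.\<close>
  have YX: "PY \<star> PX = scale (inverse (p - 1)) (single (1, 0, 0, 0) c - 1)"
  proof -
    have "gen_image Gy \<star> gen_image Gx = scale (inverse (p - 1)) (Z + scale (-1) 1)"
      unfolding image_yx by (simp add: scale_minus_one)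
    from arg_cong[OF this, of \<phi>]
    have "PY \<star> PX = scale (inverse (p - 1)) (scale c Z + scale (-1) 1)"
      unfolding PX_def PY_def by (simp only: hom_mult hom_scale hom_add img_gen img_add img_Z img_scale img_one phi_Z phi_one)
    then show ?thesis by (simp add: scale_minus_one)
  qed
  have lookup_YX: "lookup (PY \<star> PX) w = inverse (p - 1) * ((if w = (1, 0, 0, 0) then c else 0) - (if w = 0 then 1 else 0))" for w
    unfolding YX by (auto simp: lookup_minus lookup_single lookup_one when_def)
  have keys_YX: "keys (PY \<star> PX) = {(1, 0, 0, 0), 0}"
    using p1 nz(3) by (auto simp: in_keys_iff lookup_YX zero_prod_def split: if_splits)
  then have "PY \<star> PX \<noteq> 0" by (metis insert_not_empty keys_zero)
  then have X0: "PX \<noteq> 0" and Y0: "PY \<noteq> 0" by auto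
  obtain k a b i where MX: "Max (keys PX) = (k, a, b, i)" by (cases "Max (keys PX)")
  obtain k' a' b' i' where MY: "Max (keys PY) = (k', a', b', i')" by (cases "Max (keys PY)")
  have inX: "(k, a, b, i) \<in> keys PX" unfolding MX[symmetric] using X0 by (intro Max_in) auto
  have inY: "(k', a', b', i') \<in> keys PY" unfolding MY[symmetric] using Y0 by (intro Max_in) auto
  have "(k', a', b', i') + (k, a, b, i) = (1, 0, 0, 0)"
    using Max_keys_tmul[OF Y0 X0] unfolding MX MY keys_YX by (simp add: zero_prod_def)
  moreover have "0 \<le> k \<and> 0 \<le> a \<and> 0 \<le> b" "0 \<le> k' \<and> 0 \<le> a' \<and> 0 \<le> b'"
    using img_keys_nonneg[OF XM inX] img_keys_nonneg[OF YM inY] by auto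
  ultimately have ab: "a = 0" "b = 0" "a' = 0" "b' = 0" and kk: "k = 0 \<and> k' = 1 \<or> k = 1 \<and> k' = 0"
    by auto
  \<comment> \<open>In an element of the image with highest exponent \<open>(0, 0, 0, _)\<close> nonnegativity leaves no other exponent of \<open>z, s, t\<close>.\<close>
  have low: "u = 0 \<and> v = 0 \<and> w = 0"
    if "f \<in> img" "(u, v, w, j) \<in> keys f" "Max (keys f) = (0, 0, 0, j')" for f u v w j j'
    using img_keys_nonneg[OF that(1,2)] Max_ge[OF finite_keys that(2)] that(3) by auto
  have "k' \<noteq> 0"
  proof
    assume "k' = 0"
    then have "keys PY \<subseteq> {(0, 0, 0, -1)}"
      using low[OF YM] degY MY ab by (metis insertI1 prod_cases4 subsetI)
    then have Y1: "PY = single (0, 0, 0, -1) (lookup PY (0, 0, 0, -1))"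
      by (rule poly_mapping_keys_singleton)
    then have "lookup PY (1, 0, 0, -1) = 0" by (metis lookup_single_not_eq one_neq_zero Pair_inject)
    then have "lookup PY (0, 0, 0, -1) = 0"
      using img_vanish[OF YM] \<open>keys PY \<subseteq> _\<close> by auto
    then show False using Y0 Y1 by simp
  qed
  then have "k = 0" using kk by auto
  then have "keys PX \<subseteq> {(0, 0, 0, 1)}"
    using low[OF XM] degX MX ab by (metis insertI1 prod_cases4 subsetI)
  then have X1: "PX = single (0, 0, 0, 1) (lookup PX (0, 0, 0, 1))"
    by (rule poly_mapping_keys_singleton)
  define \<alpha> where "\<alpha> = lookup PX (0, 0, 0, 1)"
  have \<alpha>: "\<alpha> \<noteq> 0" "PX = single (0, 0, 0, 1) \<alpha>" using X1 X0 by (auto simp: \<alpha>_def)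
  have lookup_Y: "lookup PY u = inverse \<alpha> * lookup (PY \<star> PX) (u + (0, 0, 0, 1))" for u
    using lookup_tmul_single_right[of PY "(0, 0, 0, 1)" \<alpha> u] \<alpha> by (cases u) (simp add: tw_apply)
  have vals: "lookup PY (1, 0, 0, -1) = inverse \<alpha> * (inverse (p - 1) * c)"
    "lookup PY (0, 0, 0, -1) = - (inverse \<alpha> * inverse (p - 1))"
    by (simp_all add: lookup_Y lookup_YX zero_prod_def)
  have "keys PY \<subseteq> {(1, 0, 0, -1), (0, 0, 0, -1)}"
    by (auto simp: in_keys_iff lookup_Y lookup_YX zero_prod_def split: if_splits)
  \<comment> \<open>The two coefficients are proportional to \<open>c\<close> and \<open>-1\<close>, and their sum is the value at \<open>z = 1\<close>.\<close>
  from img_vanish[OF YM this] have "c = 1"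
    using \<alpha>(1) p1 unfolding vals by (simp add: field_simps)
  have "PY = scale (inverse \<alpha>) (gen_image Gy)"
  proof (rule tmul_right_cancel)
    show "PY \<star> PX = scale (inverse \<alpha>) (gen_image Gy) \<star> PX"
    proof -
      have "PX = scale \<alpha> (gen_image Gx)" by (simp add: \<alpha>(2))
      then have "scale (inverse \<alpha>) (gen_image Gy) \<star> PX = gen_image Gy \<star> gen_image Gx"
        using \<alpha>(1) by (simp only: tmul_scale) simp
      then show ?thesis by (simp only: YX image_yx \<open>c = 1\<close>)
    qed
  qed (rule X0)
  moreover have "PX = scale \<alpha> (gen_image Gx)" by (simp add: \<alpha>(2))
  ultimately show ?thesis using that[OF \<alpha>(1) nz(1,2)] st by (simp add: PX_def PY_def)
qed

end

context quantum_parameters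
begin

section \<open>Automorphisms of the presented algebra\<close>

abbreviation cls :: "(gen, 'k) free_alg \<Rightarrow> (gen, 'k) free_alg set" where
  "cls \<equiv> presented_class rels"

abbreviation alg :: "('k, (gen, 'k) free_alg set) module" where
  "alg \<equiv> A_alg p l m q"

lemma cls_eq_iff: "cls f = cls g \<longleftrightarrow> realize f = realize g"
  by (simp add: presented_class_eq_iff realize_eq_iff)

lemma alg_simps:
  "carrier alg = range cls"
  "cls f \<otimes>\<^bsub>alg\<^esub> cls g = cls (f * g)"
  "\<one>\<^bsub>alg\<^esub> = cls 1"
  "cls f \<oplus>\<^bsub>alg\<^esub> cls g = cls (f + g)"
  "c \<odot>\<^bsub>alg\<^esub> cls f = cls (scale c f)"
  by (simp_all add: A_alg_def presented_simps)

lemma gen_cls: "A_gen p l m q g = cls (free_var g)"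
  by (simp add: A_gen_def)

lemma automorphism_iff:
  "h \<in> carrier (algebra_AutoGroup alg) \<longleftrightarrow> h \<in> Bij (range cls) \<and> h (cls 1) = cls 1 \<and>
    (\<forall>f g. h (cls (f * g)) = h (cls f) \<otimes>\<^bsub>alg\<^esub> h (cls g)) \<and>
    (\<forall>f g. h (cls (f + g)) = h (cls f) \<oplus>\<^bsub>alg\<^esub> h (cls g)) \<and>
    (\<forall>c f. h (cls (scale c f)) = c \<odot>\<^bsub>alg\<^esub> h (cls f))"
proof -
  have all2: "(\<forall>x y. x \<in> range cls \<and> y \<in> range cls \<longrightarrow> P x y) \<longleftrightarrow> (\<forall>f g. P (cls f) (cls g))" for P
    by auto
  show ?thesis
    using Bij_imp_funcset[of h "range cls"]
    unfolding algebra_AutoGroup_def algebra_hom_def ring_hom_def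
    by (simp add: alg_simps all2) blast
qed

lemma automorphism_image:
  assumes "h \<in> carrier (algebra_AutoGroup alg)"
  obtains f' where "h (cls f) = cls f'"
proof -
  have "h \<in> Bij (range cls)" using assms by (simp add: automorphism_iff)
  then have "h (cls f) \<in> range cls" by (rule funcset_mem[OF Bij_imp_funcset]) (rule rangeI)
  then show ?thesis using that by blast
qed

lemma automorphism_eqI:
  assumes h: "h \<in> carrier (algebra_AutoGroup alg)" and h': "h' \<in> carrier (algebra_AutoGroup alg)"
    and eq: "\<And>g. h (cls (free_var g)) = h' (cls (free_var g))"
  shows "h = h'"
proof (rule extensionalityI)
  show "h \<in> extensional (range cls)" "h' \<in> extensional (range cls)"
    using h h' by (auto simp: automorphism_iff Bij_imp_extensional)
  fix C assume "C \<in> range cls"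
  moreover have "h (cls f) = h' (cls f)" for f
    using h h' eq by (induction f rule: free_alg_induct) (auto simp: automorphism_iff)
  ultimately show "h C = h' C" by auto
qed

text \<open>
  The algebra is identified with its image in the torus, and the automorphism is carried over along
  this identification.
\<close>

lemma automorphism_is_scaling:
  assumes h: "h \<in> carrier (algebra_AutoGroup alg)"
  obtains \<alpha> \<beta> \<gamma> where "\<alpha> \<noteq> 0" "\<beta> \<noteq> 0" "\<gamma> \<noteq> 0" "is_scaling p l m q \<alpha> \<beta> \<gamma> h"
proof -
  \<comment> \<open>The two directions of the identification, by choice of representatives in the free algebra.\<close>
  define up where "up u = cls (SOME f. realize f = u)" for u
  define down where "down C = realize (SOME f. cls f = C)" for C
  have up: "up (realize f) = cls f" for f
    unfolding up_def cls_eq_iff by (rule someI) (rule refl)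
  have down: "down (cls f) = realize f" for f
    unfolding down_def cls_eq_iff[symmetric] by (rule someI) (rule refl)
  define \<phi> where "\<phi> = (\<lambda>u. down (h (up u)))"
  have \<phi>: "\<phi> (realize f) = realize f' \<longleftrightarrow> h (cls f) = cls f'" for f f'
    using automorphism_image[OF h, of f] by (metis \<phi>_def cls_eq_iff down up)
  have ex: "\<exists>f'. h (cls f) = cls f'" for f using automorphism_image[OF h] by metis
  have bij_h: "bij_betw h (range cls) (range cls)" using h by (simp add: automorphism_iff Bij_def)
  interpret image_automorphism p q l m \<phi>
  proof
    have "bij_betw up img (range cls)"
      by (rule bij_betw_byWitness[where f' = down]) (auto simp: img_def up down)
    moreover have "bij_betw down (range cls) img"
      by (rule bij_betw_byWitness[where f' = up]) (auto simp: img_def up down)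
    ultimately have "bij_betw (down \<circ> (h \<circ> up)) img img"
      using bij_h by (blast intro: bij_betw_trans)
    then show "bij_betw \<phi> img img" by (simp add: \<phi>_def comp_def)
  next
    fix f g assume "f \<in> img" "g \<in> img"
    then obtain F G where FG: "f = realize F" "g = realize G" by (auto simp: img_def)
    obtain F' G' where "h (cls F) = cls F'" "h (cls G) = cls G'" using ex by meson
    moreover from this have "h (cls (F + G)) = cls (F' + G')" "h (cls (F * G)) = cls (F' * G')"
      using h by (simp_all add: automorphism_iff alg_simps)
    ultimately show "\<phi> (f + g) = \<phi> f + \<phi> g" "\<phi> (f \<star> g) = \<phi> f \<star> \<phi> g"
      unfolding FG realize_add[symmetric] realize_mult[symmetric] by (simp_all flip: \<phi>)
  next
    fix f c assume "f \<in> img"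
    then obtain F where F: "f = realize F" by (auto simp: img_def)
    obtain F' where "h (cls F) = cls F'" using ex by meson
    moreover from this have "h (cls (scale c F)) = cls (scale c F')"
      using h by (simp add: automorphism_iff alg_simps)
    ultimately show "\<phi> (scale c f) = scale c (\<phi> f)"
      unfolding F realize_scale[symmetric] by (simp flip: \<phi>)
  qed
  have lift: "h (cls (free_var g)) = c \<odot>\<^bsub>alg\<^esub> cls (free_var g)"
    if "\<phi> (gen_image g) = scale c (gen_image g)" for g c
    using that \<phi>[of "free_var g" "scale c (free_var g)"] by (simp add: alg_simps)
  obtain \<alpha> \<beta> \<gamma> where "\<alpha> \<noteq> 0" "\<beta> \<noteq> 0" "\<gamma> \<noteq> 0"
    "\<phi> (gen_image Gx) = scale \<alpha> (gen_image Gx)" "\<phi> (gen_image Gy) = scale (inverse \<alpha>) (gen_image Gy)"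
    "\<phi> (gen_image Gs) = scale \<beta> (gen_image Gs)" "\<phi> (gen_image Gt) = scale \<gamma> (gen_image Gt)"
    by (rule phi_is_scaling)
  then show ?thesis using that[of \<alpha> \<beta> \<gamma>] by (simp add: is_scaling_def gen_cls lift)
qed

text \<open>
  The endomorphism of the free algebra that multiplies the generator \<open>g\<close> by \<open>w g\<close>.
\<close>

definition rescale :: "(gen \<Rightarrow> 'k) \<Rightarrow> (gen, 'k) free_alg \<Rightarrow> (gen, 'k) free_alg" where
  "rescale w = lin_ext (\<lambda>u a. single u (a * prod_list (map w (unword u))))"

lemma rescale_single: "rescale w (single u a) = single u (a * prod_list (map w (unword u)))"
  by (simp add: rescale_def lin_ext_single)

lemma rescale_add [simp]: "rescale w (f + g) = rescale w f + rescale w g"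
  unfolding rescale_def by (rule lin_ext_add) (simp add: ring_distribs single_add)

lemma rescale_scale [simp]: "rescale w (scale c f) = scale c (rescale w f)"
  by (induction f rule: poly_mapping_add_induct) (simp_all add: rescale_single scale_add mult.assoc)

lemma rescale_minus [simp]: "rescale w (- f) = - rescale w f"
  by (simp flip: scale_minus_one)

lemma rescale_diff [simp]: "rescale w (f - g) = rescale w f - rescale w g"
  using rescale_add[of w f "- g"] by (simp del: rescale_add)

lemma rescale_one [simp]: "rescale w 1 = 1"
  using rescale_single[of w 0 1] by simp

lemma rescale_mult [simp]: "rescale w (f * g) = rescale w f * rescale w g"
proof (induction f rule: poly_mapping_add_induct)
  case (single u a)
  show ?case
    by (induction g rule: poly_mapping_add_induct)
       (simp_all add: mult_single rescale_single unword_add ring_distribs mult_ac)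
qed (simp add: ring_distribs)

lemma rescale_var [simp]: "rescale w (free_var g) = scale (w g) (free_var g)"
  by (simp add: free_var_def rescale_single)

lemma rescale_inverse:
  assumes "\<And>g. w g * w' g = 1"
  shows "rescale w (rescale w' f) = f"
proof (induction f rule: free_alg_induct)
  case (var g f)
  then show ?case using assms[of g] by (simp add: scale_mult_left scale_mult_right mult.commute)
qed simp_all

text \<open>
  All relations except \<open>xy - pyx = 1\<close> are homogeneous in every generator, and that one is homogeneous
  when \<open>x\<close> and \<open>y\<close> have inverse weights.
\<close>

lemma realize_rescale_cong:
  assumes w: "w Gx * w Gy = 1" and eq: "realize f = realize g"
  shows "realize (rescale w f) = realize (rescale w g)"
proof -
  have "relation_ideal rels \<subseteq> {h. realize (rescale w h) = 0}"
  proof (rule relation_ideal_least)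
    have w': "w Gy * w Gx = 1" using w by (simp add: mult.commute)
    show "rels \<subseteq> {h. realize (rescale w h) = 0}"
      using image_relation_xy skew_gen_images w w'
      unfolding A_relations_def
      by (auto simp: free_const_mult scale_mult_left scale_mult_right tmul_scale mult_ac simp del: gen_image.simps)
    show "0 \<in> {h. realize (rescale w h) = 0}" by (simp add: rescale_def lin_ext_def)
  qed auto
  moreover have "f - g \<in> relation_ideal rels" using eq by (simp add: realize_eq_iff cong_rel_def)
  ultimately have "realize (rescale w (f - g)) = 0" by blast
  then show ?thesis by simp
qed

text \<open>
  The rescaling of words descends to the algebra; the rescaling with the inverse weights is inverse
  to it.
\<close>

lemma scaling_automorphism_exists:
  assumes w: "w Gx * w Gy = 1" "w Gs \<noteq> 0" "w Gt \<noteq> 0"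
  shows "\<exists>h \<in> carrier (algebra_AutoGroup alg). \<forall>g. h (cls (free_var g)) = w g \<odot>\<^bsub>alg\<^esub> cls (free_var g)"
proof -
  define H where "H v = restrict (\<lambda>C. cls (rescale v (SOME f. cls f = C))) (range cls)" for v
  have H: "H v (cls f) = cls (rescale v f)" if "v Gx * v Gy = 1" for v f
  proof -
    have "cls (SOME g. cls g = cls f) = cls f" by (rule someI) (rule refl)
    then have "realize (SOME g. cls g = cls f) = realize f" by (rule iffD1[OF cls_eq_iff])
    then have "cls (rescale v (SOME g. cls g = cls f)) = cls (rescale v f)"
      by (intro iffD2[OF cls_eq_iff] realize_rescale_cong[OF that])
    then show ?thesis by (simp add: H_def)
  qed
  define w' where "w' g = inverse (w g)" for g
  have nz: "w g \<noteq> 0" for g using w by (cases g) auto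
  have ww: "w g * w' g = 1" "w' g * w g = 1" for g using nz by (simp_all add: w'_def)
  have w': "w' Gx * w' Gy = 1" using w(1) by (simp add: w'_def flip: inverse_mult_distrib)
  have "bij_betw (H w) (range cls) (range cls)"
    by (rule bij_betw_byWitness[where f' = "H w'"])
       (auto simp: H w(1) w' rescale_inverse ww)
  then have "H w \<in> Bij (range cls)" by (simp add: Bij_def H_def)
  then have "H w \<in> carrier (algebra_AutoGroup alg)"
    by (simp add: automorphism_iff H w(1) alg_simps)
  then show ?thesis by (intro bexI[of _ "H w"]) (auto simp: H w(1) alg_simps)
qed

lemma scaling_ex1:
  assumes "\<alpha> \<noteq> 0" "\<beta> \<noteq> 0" "\<gamma> \<noteq> 0"
  shows "\<exists>!h. h \<in> carrier (algebra_AutoGroup alg) \<and> is_scaling p l m q \<alpha> \<beta> \<gamma> h"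
proof -
  define w where "w g = (case g of Gx \<Rightarrow> \<alpha> | Gy \<Rightarrow> inverse \<alpha> | Gs \<Rightarrow> \<beta> | Gt \<Rightarrow> \<gamma>)" for g
  have iff: "is_scaling p l m q \<alpha> \<beta> \<gamma> h \<longleftrightarrow> (\<forall>g. h (cls (free_var g)) = w g \<odot>\<^bsub>alg\<^esub> cls (free_var g))" for h
  proof -
    have "(\<forall>g. P g) \<longleftrightarrow> P Gx \<and> P Gy \<and> P Gs \<and> P Gt" for P by (metis gen.exhaust)
    then show ?thesis by (simp add: is_scaling_def gen_cls w_def)
  qed
  have "\<exists>h. h \<in> carrier (algebra_AutoGroup alg) \<and> is_scaling p l m q \<alpha> \<beta> \<gamma> h"
    unfolding iff using scaling_automorphism_exists[of w] assms by (auto simp: w_def)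
  moreover have "h = h'" if "h \<in> carrier (algebra_AutoGroup alg) \<and> is_scaling p l m q \<alpha> \<beta> \<gamma> h"
    "h' \<in> carrier (algebra_AutoGroup alg) \<and> is_scaling p l m q \<alpha> \<beta> \<gamma> h'" for h h'
    using that unfolding iff by (intro automorphism_eqI) auto
  ultimately show ?thesis by blast
qed

lemma scaling_aut:
  assumes "\<alpha> \<noteq> 0" "\<beta> \<noteq> 0" "\<gamma> \<noteq> 0"
  shows "scaling_aut p l m q \<alpha> \<beta> \<gamma> \<in> carrier (algebra_AutoGroup alg)"
    and "is_scaling p l m q \<alpha> \<beta> \<gamma> (scaling_aut p l m q \<alpha> \<beta> \<gamma>)"
proof -
  have *: "scaling_aut p l m q \<alpha> \<beta> \<gamma> \<in> carrier (algebra_AutoGroup alg) \<and>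
      is_scaling p l m q \<alpha> \<beta> \<gamma> (scaling_aut p l m q \<alpha> \<beta> \<gamma>)"
    unfolding scaling_aut_def by (rule theI'[OF scaling_ex1[OF assms]])
  show "scaling_aut p l m q \<alpha> \<beta> \<gamma> \<in> carrier (algebra_AutoGroup alg)" by (rule conjunct1[OF *])
  show "is_scaling p l m q \<alpha> \<beta> \<gamma> (scaling_aut p l m q \<alpha> \<beta> \<gamma>)" by (rule conjunct2[OF *])
qed

lemma scaling_aut_eqI:
  assumes "\<alpha> \<noteq> 0" "\<beta> \<noteq> 0" "\<gamma> \<noteq> 0" "h \<in> carrier (algebra_AutoGroup alg)" "is_scaling p l m q \<alpha> \<beta> \<gamma> h"
  shows "h = scaling_aut p l m q \<alpha> \<beta> \<gamma>"
  using scaling_ex1[OF assms(1-3)]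
proof (rule ex1E)
  fix k assume k: "\<forall>h'. h' \<in> carrier (algebra_AutoGroup alg) \<and> is_scaling p l m q \<alpha> \<beta> \<gamma> h' \<longrightarrow> h' = k"
  have "h = k" using k assms(4,5) by simp
  moreover have "scaling_aut p l m q \<alpha> \<beta> \<gamma> = k"
    using k scaling_aut[OF assms(1-3)] by simp
  ultimately show ?thesis by simp
qed

lemma carrier_AutoGroup:
  "carrier (algebra_AutoGroup alg) =
    {scaling_aut p l m q \<alpha> \<beta> \<gamma> | \<alpha> \<beta> \<gamma>. \<alpha> \<noteq> 0 \<and> \<beta> \<noteq> 0 \<and> \<gamma> \<noteq> 0}"
proof (intro equalityI subsetI)
  fix h assume h: "h \<in> carrier (algebra_AutoGroup alg)"
  then obtain \<alpha> \<beta> \<gamma> where "\<alpha> \<noteq> 0" "\<beta> \<noteq> 0" "\<gamma> \<noteq> 0" "is_scaling p l m q \<alpha> \<beta> \<gamma> h"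
    by (rule automorphism_is_scaling)
  then show "h \<in> {scaling_aut p l m q \<alpha> \<beta> \<gamma> | \<alpha> \<beta> \<gamma>. \<alpha> \<noteq> 0 \<and> \<beta> \<noteq> 0 \<and> \<gamma> \<noteq> 0}"
    using scaling_aut_eqI[OF _ _ _ h] by (intro CollectI exI[of _ \<alpha>] exI[of _ \<beta>] exI[of _ \<gamma>]) simp
next
  fix h assume "h \<in> {scaling_aut p l m q \<alpha> \<beta> \<gamma> | \<alpha> \<beta> \<gamma>. \<alpha> \<noteq> 0 \<and> \<beta> \<noteq> 0 \<and> \<gamma> \<noteq> 0}"
  then obtain \<alpha> \<beta> \<gamma> where "h = scaling_aut p l m q \<alpha> \<beta> \<gamma>" "\<alpha> \<noteq> 0" "\<beta> \<noteq> 0" "\<gamma> \<noteq> 0"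
    by (elim CollectE exE conjE)
  then show "h \<in> carrier (algebra_AutoGroup alg)" using scaling_aut(1) by simp
qed

lemma mult_AutoGroup:
  assumes h: "h \<in> carrier (algebra_AutoGroup alg)" and h': "h' \<in> carrier (algebra_AutoGroup alg)"
  shows "h \<otimes>\<^bsub>algebra_AutoGroup alg\<^esub> h' \<in> carrier (algebra_AutoGroup alg)"
    and "(h \<otimes>\<^bsub>algebra_AutoGroup alg\<^esub> h') (cls f) = h (h' (cls f))"
proof -
  have B: "h \<in> Bij (range cls)" "h' \<in> Bij (range cls)" using h h' by (auto simp: automorphism_iff)
  have m: "h \<otimes>\<^bsub>algebra_AutoGroup alg\<^esub> h' = compose (range cls) h h'"
    using B by (simp add: algebra_AutoGroup_def BijGroup_def alg_simps)
  show *: "(h \<otimes>\<^bsub>algebra_AutoGroup alg\<^esub> h') (cls f) = h (h' (cls f))" for f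
    by (simp add: m compose_eq)
  have "h (h' (cls f) \<otimes>\<^bsub>alg\<^esub> h' (cls g)) = h (h' (cls f)) \<otimes>\<^bsub>alg\<^esub> h (h' (cls g))"
    "h (h' (cls f) \<oplus>\<^bsub>alg\<^esub> h' (cls g)) = h (h' (cls f)) \<oplus>\<^bsub>alg\<^esub> h (h' (cls g))"
    "h (c \<odot>\<^bsub>alg\<^esub> h' (cls f)) = c \<odot>\<^bsub>alg\<^esub> h (h' (cls f))" for f g c
  proof -
    obtain f' g' where "h' (cls f) = cls f'" "h' (cls g) = cls g'" using automorphism_image[OF h'] by meson
    then show "h (h' (cls f) \<otimes>\<^bsub>alg\<^esub> h' (cls g)) = h (h' (cls f)) \<otimes>\<^bsub>alg\<^esub> h (h' (cls g))"
      "h (h' (cls f) \<oplus>\<^bsub>alg\<^esub> h' (cls g)) = h (h' (cls f)) \<oplus>\<^bsub>alg\<^esub> h (h' (cls g))"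
      "h (c \<odot>\<^bsub>alg\<^esub> h' (cls f)) = c \<odot>\<^bsub>alg\<^esub> h (h' (cls f))"
      using h by (simp_all add: automorphism_iff alg_simps)
  qed
  then show "h \<otimes>\<^bsub>algebra_AutoGroup alg\<^esub> h' \<in> carrier (algebra_AutoGroup alg)"
    using h h' compose_Bij[OF B] by (simp add: automorphism_iff *) (simp add: m)
qed

lemma scaling_aut_gen:
  assumes "\<alpha> \<noteq> 0" "\<beta> \<noteq> 0" "\<gamma> \<noteq> 0"
  shows "scaling_aut p l m q \<alpha> \<beta> \<gamma> (cls gx) = cls (scale \<alpha> gx)"
    "scaling_aut p l m q \<alpha> \<beta> \<gamma> (cls gy) = cls (scale (inverse \<alpha>) gy)"
    "scaling_aut p l m q \<alpha> \<beta> \<gamma> (cls gs) = cls (scale \<beta> gs)"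
    "scaling_aut p l m q \<alpha> \<beta> \<gamma> (cls gt) = cls (scale \<gamma> gt)"
  using scaling_aut(2)[OF assms] by (simp_all add: is_scaling_def gen_cls alg_simps)

lemma scaling_aut_mult:
  assumes nz: "\<alpha> \<noteq> 0" "\<beta> \<noteq> 0" "\<gamma> \<noteq> 0" "\<alpha>' \<noteq> 0" "\<beta>' \<noteq> 0" "\<gamma>' \<noteq> 0"
  shows "scaling_aut p l m q \<alpha> \<beta> \<gamma> \<otimes>\<^bsub>algebra_AutoGroup alg\<^esub> scaling_aut p l m q \<alpha>' \<beta>' \<gamma>' =
    scaling_aut p l m q (\<alpha> * \<alpha>') (\<beta> * \<beta>') (\<gamma> * \<gamma>')"
proof (rule scaling_aut_eqI)
  let ?h = "scaling_aut p l m q \<alpha> \<beta> \<gamma>" and ?h' = "scaling_aut p l m q \<alpha>' \<beta>' \<gamma>'"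
  note h = scaling_aut(1)[OF nz(1-3)] and h' = scaling_aut(1)[OF nz(4-6)]
  show "?h \<otimes>\<^bsub>algebra_AutoGroup alg\<^esub> ?h' \<in> carrier (algebra_AutoGroup alg)"
    by (rule mult_AutoGroup[OF h h'])
  have hs: "?h (cls (scale c f)) = c \<odot>\<^bsub>alg\<^esub> ?h (cls f)" for c f
    using h by (simp add: automorphism_iff)
  show "is_scaling p l m q (\<alpha> * \<alpha>') (\<beta> * \<beta>') (\<gamma> * \<gamma>') (?h \<otimes>\<^bsub>algebra_AutoGroup alg\<^esub> ?h')"
    by (simp add: is_scaling_def gen_cls mult_AutoGroup(2)[OF h h'] scaling_aut_gen nz hs alg_simps mult.commute)
qed (use nz in auto)

lemma scale_cls_inj: "cls (scale c (free_var g)) = cls (scale d (free_var g)) \<Longrightarrow> g \<noteq> Gy \<Longrightarrow> c = d"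
  by (cases g) (simp_all add: cls_eq_iff, (metis lookup_single_eq)+)

end

lemma carrier_mult_group: "carrier (mult_group :: 'k::field monoid) = {a. a \<noteq> 0}"
proof -
  have "\<exists>b. b * a = 1 \<and> a * b = 1" if "a \<noteq> 0" for a :: 'k
    using that by (intro exI[of _ "inverse a"]) simp
  then show ?thesis by (auto simp: units_of_def Units_def ring_of_type_algebra_def)
qed

lemma mult_mult_group: "a \<otimes>\<^bsub>mult_group\<^esub> b = a * (b :: 'k::field)"
  by (simp add: units_of_def ring_of_type_algebra_def)

lemma group_mult_group: "group (mult_group :: 'k::field monoid)"
proof -
  interpret ring "ring_of_type_algebra :: 'k ring" by (rule ring_ring_of_type_algebra)
  show ?thesis by (rule units_group)
qed

lemma (in quantum_parameters) AutoGroup_iso: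
  "algebra_AutoGroup alg \<cong> (mult_group :: 'k monoid) \<times>\<times> (mult_group :: 'k monoid) \<times>\<times> (mult_group :: 'k monoid)"
proof -
  let ?T = "(mult_group :: 'k monoid) \<times>\<times> (mult_group :: 'k monoid) \<times>\<times> (mult_group :: 'k monoid)"
  let ?f = "\<lambda>(\<alpha>, \<beta>, \<gamma>). scaling_aut p l m q \<alpha> \<beta> \<gamma>"
  have "?f \<in> hom ?T (algebra_AutoGroup alg)"
    by (rule homI) (auto simp: carrier_mult_group mult_mult_group scaling_aut scaling_aut_mult)
  moreover have "inj_on ?f (carrier ?T)"
  proof (rule inj_onI, clarsimp simp: carrier_mult_group)
    fix \<alpha> \<beta> \<gamma> \<alpha>' \<beta>' \<gamma>' :: 'k
    assume nz: "\<alpha> \<noteq> 0" "\<beta> \<noteq> 0" "\<gamma> \<noteq> 0" "\<alpha>' \<noteq> 0" "\<beta>' \<noteq> 0" "\<gamma>' \<noteq> 0"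
      and eq: "scaling_aut p l m q \<alpha> \<beta> \<gamma> = scaling_aut p l m q \<alpha>' \<beta>' \<gamma>'"
    show "\<alpha> = \<alpha>' \<and> \<beta> = \<beta>' \<and> \<gamma> = \<gamma>'"
      using scaling_aut_gen[OF nz(1-3)] scaling_aut_gen[OF nz(4-6)]
      unfolding eq by (auto intro: scale_cls_inj)
  qed
  moreover have "?f ` carrier ?T = carrier (algebra_AutoGroup alg)"
    unfolding carrier_AutoGroup by (force simp: carrier_mult_group)
  ultimately have iso: "?T \<cong> algebra_AutoGroup alg"
    unfolding is_iso_def iso_def bij_betw_def by blast
  have "group ?T" by (intro DirProd_group group_mult_group)
  then show ?thesis using iso by (rule group.iso_sym)
qed

theorem theorem2p2:
  fixes p q l m :: "'k::field"
  assumes "p \<noteq> 0" and "q \<noteq> 0" and "l \<noteq> 0" and "m \<noteq> 0"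
    and "\<not> is_root_of_unity p" and "\<not> is_root_of_unity q"
  shows "(\<forall>\<alpha> \<beta> \<gamma>. \<alpha> \<noteq> 0 \<longrightarrow> \<beta> \<noteq> 0 \<longrightarrow> \<gamma> \<noteq> 0 \<longrightarrow>
            (\<exists>!h. h \<in> carrier (algebra_AutoGroup (A_alg p l m q)) \<and> is_scaling p l m q \<alpha> \<beta> \<gamma> h)) \<and>
         carrier (algebra_AutoGroup (A_alg p l m q)) =
           {scaling_aut p l m q \<alpha> \<beta> \<gamma> | \<alpha> \<beta> \<gamma>. \<alpha> \<noteq> 0 \<and> \<beta> \<noteq> 0 \<and> \<gamma> \<noteq> 0} \<and>
         algebra_AutoGroup (A_alg p l m q) \<cong>
           (mult_group :: 'k monoid) \<times>\<times> (mult_group :: 'k monoid) \<times>\<times> (mult_group :: 'k monoid)"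
proof -
  interpret quantum_parameters p q l m using assms by unfold_locales
  show ?thesis using scaling_ex1 carrier_AutoGroup AutoGroup_iso by blast
qed

end
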